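(* Let $T$, $\Gamma$, $V$, $W$, $J$, $R$, $\mathcal{V}$, $A_0$, $A_1$, $V_0$ be as in the context, let $F(z)=A_1V_0-zA_0V_0$, and let $M=\sup_{z\in\mathrm{int}(\Gamma)}\|R(z)\|$. Then for all sufficiently small $\delta>0$, $$\Lambda_{\delta_1}(T)\cap \mathrm{int}(\Gamma) \subset \Lambda_{\delta}(F) \cap \mathrm{int}(\Gamma)\subset\Lambda_{\delta_2}(T) \cap \mathrm{int}(\Gamma),$$ where $$\delta_1 = \frac{\delta}{\|VW^*\|\,\|VW^*\mathcal{V}\| + M\delta},\qquad \delta_2 = \frac{\delta}{\sigma_m(VW^* )\,\sigma_m(VW^*\mathcal{V})- M\delta}.$$
   Context: Nonlinear eigenproblem: $\Omega\subset\mathbb{C}$ is a non-empty domain, $\mathcal{H}$ a Hilbert space, and for each $z\in\Omega$, $T(z)$ is a closed linear operator in $\mathcal{H}$ with densely defined domain $\mathcal{D}(T)$ independent of $z$, such that $z\mapsto T(z)u$ is holomorphic on $\Omega$ for each $u\in\mathcal{D}(T)$, and $T(z)$ is Fredholm for all $z\in\Omega$. $\Lambda(T)$ is the set of $z\in\Omega$ for which $T(z)$ is not invertible (no bounded everywhere defined inverse), and $\rho(T)=\Omega\setminus\Lambda(T)$. Contour: $\Gamma\subset\Omega$ is a closed rectifiable Jordan curve that does not intersect $\Lambda(T)$ and bounds a simply connected region $\mathrm{int}(\Gamma)\subset\Omega$ containing eigenvalues $\lambda_1,\dots,\lambda_m$ of $T$ (counted with algebraic multiplicity; these are all the points of $\Lambda(T)$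 in $\mathrm{int}(\Gamma)$). Keldysh's expansion (known theorem, used to define $V,W,J,R$): on a neighbourhood of the closure of $\mathrm{int}(\Gamma)$, for $z\in\rho(T)$, $$T(z)^{-1}=V(zI-J)^{-1}W^*+R(z),$$ where $V,W$ are quasimatrices with $m$ columns in $\mathcal{H}$ (i.e. linear maps $\mathbb{C}^m\to\mathcal{H}$) consisting of suitably normalized generalized right and left eigenvectors of $T$, $J\in\mathbb{C}^{m\times m}$ is block diagonal with the Jordan blocks of the eigenvalues inside $\Gamma$, and $R$ is holomorphic with values in the bounded operators on $\mathcal{H}$. Test functions: $\mathcal{V}$ is a fixed realization of a random quasimatrix with $m+p$ columns in $\mathcal{H}$ (a linear map $\mathbb{C}^{m+p}\to\mathcal{H}$), where $p\ge 0$ is an oversampling integer. When $\mathcal{H}=L^2(\mathcal{X})$, $\mathcal{X}\subseteq\mathbb{R}^d$, the columns are drawn independently from the mean-zero Gaussian process with covariance kernel $K_{\mathrm{SE}}(x,y)=\frac{1}{\mu\sqrt{2\pi}}\exp(-(x-y)^2/(2\mu^2))$, $\mu>0$; the process is analogous for other Hilbert spaces. Exact contour integrals: $$A_0=\frac{1}{2\pi i}\int_\Gamma T(z)^{-1}\mathcal{V}\,dz=VW^*\mathcal{V},\qquad A_1=\frac{1}{2\pi i}\int_\Gamma zT(z)^{-1}\mathcal{V}\,dz=VJW^*\mathcal{V}.$$ It is assumed that $A_0$ and $A_1$ have rank $m$. $A_0=\mathcal{U}\Sigma_0V_0^*$ is the economized singular value decomposition, where $\mathcal{U}$ is a quasimatrix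 with $m$ orthonormal columns in $\mathcal{H}$, $\Sigma_0\in\mathbb{C}^{m\times m}$ is diagonal, and $V_0\in\mathbb{C}^{(m+p)\times m}$ has orthonormal columns. It is assumed that $VW^*\mathcal{V}V_0$ has rank $m$. Thus $F(z):\mathbb{C}^m\to\mathcal{H}$. Notation: norms are operator norms; $\sigma_m(\cdot)$ is the $m$-th largest singular value. $\Lambda_\epsilon(T)=\bigcup_E\Lambda(T+E)$, the union over all holomorphic $E:\Omega\to\mathcal{B}(\mathcal{H})$ with $\sup_{z\in\Omega}\|E(z)\|<\epsilon$. $\Lambda_\delta(F)=\{z:\sigma_{\mathrm{inf}}(F(z))<\delta\}$, with $\sigma_{\mathrm{inf}}(F(z))=\min\{\|F(z)x\|:x\in\mathbb{C}^m,\|x\|=1\}$. *)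

theory Defs
  imports "HOL-Complex_Analysis.Complex_Analysis"
begin

subsection \<open>Complex Hilbert spaces\<close>

class scaleC =
  fixes scaleC :: "complex \<Rightarrow> 'a \<Rightarrow> 'a" (infixr "*\<^sub>C" 75)

class complex_vector = real_vector + scaleC +
  assumes scaleC_add_right: "c *\<^sub>C (x + y) = c *\<^sub>C x + c *\<^sub>C y"
    and scaleC_add_left: "(c + d) *\<^sub>C x = c *\<^sub>C x + d *\<^sub>C x"
    and scaleC_scaleC: "c *\<^sub>C d *\<^sub>C x = (c * d) *\<^sub>C x"
    and scaleC_one: "1 *\<^sub>C x = x"
    and scaleR_scaleC: "r *\<^sub>R x = complex_of_real r *\<^sub>C x"

class complex_normed_vector = complex_vector + real_normed_vector +
  assumes norm_scaleC: "norm (c *\<^sub>C x) = cmod c * norm x"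

text \<open>The inner product is conjugate linear in its first argument.\<close>

class complex_inner = complex_normed_vector +
  fixes cinner :: "'a \<Rightarrow> 'a \<Rightarrow> complex"
  assumes cinner_commute: "cinner x y = cnj (cinner y x)"
    and cinner_add_right: "cinner x (y + z) = cinner x y + cinner x z"
    and cinner_scaleC_right: "cinner x (c *\<^sub>C y) = c * cinner x y"
    and cinner_self: "cinner x x = complex_of_real ((norm x)\<^sup>2)"

class chilbert_space = complex_inner + complete_space

global_interpretation complex_vector: vector_space "scaleC :: complex \<Rightarrow> 'a \<Rightarrow> 'a::complex_vector"
  by unfold_locales (simp_all add: scaleC_add_right scaleC_add_left scaleC_scaleC scaleC_one)

abbreviation clinear :: "('a::complex_vector \<Rightarrow> 'b::complex_vector) \<Rightarrow> bool"
  where "clinear \<equiv> Vector_Spaces.linear scaleC scaleC"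

instantiation complex :: complex_inner
begin

definition scaleC_complex :: "complex \<Rightarrow> complex \<Rightarrow> complex"
  where "scaleC_complex c x = c * x"

definition cinner_complex :: "complex \<Rightarrow> complex \<Rightarrow> complex"
  where "cinner_complex x y = cnj x * y"

instance
  by standard
    (simp_all add: scaleC_complex_def cinner_complex_def algebra_simps scaleR_conv_of_real
      norm_mult complex_norm_square[symmetric] del: of_real_power)

end

instance complex :: chilbert_space ..

instantiation vec :: (complex_vector, finite) complex_vector
begin

definition scaleC_vec :: "complex \<Rightarrow> 'a ^ 'b \<Rightarrow> 'a ^ 'b"
  where "scaleC_vec c x = (\<chi> i. c *\<^sub>C x $ i)"

instance
  by standard
    (simp_all add: scaleC_vec_def vec_eq_iff scaleC_add_right scaleC_add_left scaleC_scaleC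
      scaleC_one scaleR_scaleC)

end

instance vec :: (complex_normed_vector, finite) complex_normed_vector
  by standard (simp add: norm_vec_def scaleC_vec_def norm_scaleC L2_set_right_distrib)

instantiation vec :: (complex_inner, finite) complex_inner
begin

definition cinner_vec :: "'a ^ 'b \<Rightarrow> 'a ^ 'b \<Rightarrow> complex"
  where "cinner_vec x y = (\<Sum>i\<in>UNIV. cinner (x $ i) (y $ i))"

instance
proof
  fix x y z :: "'a ^ 'b" and c :: complex
  show "cinner x y = cnj (cinner y x)"
    unfolding cinner_vec_def cnj_sum by (rule sum.cong[OF refl]) (rule cinner_commute)
  show "cinner x (y + z) = cinner x y + cinner x z"
    by (simp add: cinner_vec_def cinner_add_right sum.distrib)
  show "cinner x (c *\<^sub>C y) = c * cinner x y"
    by (simp add: cinner_vec_def scaleC_vec_def cinner_scaleC_right sum_distrib_left)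
  show "cinner x x = complex_of_real ((norm x)\<^sup>2)"
    by (simp add: cinner_vec_def cinner_self norm_vec_def L2_set_def sum_nonneg)
qed

end

instance vec :: (chilbert_space, finite) chilbert_space ..

text \<open>The scalar multiple \<open>c A\<close> of an operator is formed pointwise; for a complex linear
  operator the norm of \<open>'a \<Rightarrow>\<^sub>L 'b\<close> is the usual operator norm.\<close>

instantiation blinfun :: (real_normed_vector, complex_normed_vector) complex_normed_vector
begin

lift_definition scaleC_blinfun :: "complex \<Rightarrow> 'a \<Rightarrow>\<^sub>L 'b \<Rightarrow> 'a \<Rightarrow>\<^sub>L 'b" is "\<lambda>c f x. c *\<^sub>C f x"
proof -
  fix c :: complex and f :: "'a \<Rightarrow> 'b"
  assume f: "bounded_linear f"
  show "bounded_linear (\<lambda>x. c *\<^sub>C f x)"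
  proof (rule bounded_linear_intro[where K = "cmod c * onorm f"])
    fix x y :: 'a and r :: real
    show "c *\<^sub>C f (x + y) = c *\<^sub>C f x + c *\<^sub>C f y"
      by (simp add: linear_add bounded_linear.linear[OF f] scaleC_add_right)
    show "c *\<^sub>C f (r *\<^sub>R x) = r *\<^sub>R (c *\<^sub>C f x)"
      by (simp add: linear_cmul bounded_linear.linear[OF f] scaleR_scaleC scaleC_scaleC mult.commute)
    show "norm (c *\<^sub>C f x) \<le> norm x * (cmod c * onorm f)"
      using mult_left_mono[OF onorm[OF f, of x], of "cmod c"] by (simp add: norm_scaleC mult_ac)
  qed
qed

instance
proof
  fix f g :: "'a \<Rightarrow>\<^sub>L 'b" and c d :: complex and r :: real
  show "c *\<^sub>C (f + g) = c *\<^sub>C f + c *\<^sub>C g"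
    by transfer (simp add: scaleC_add_right)
  show "(c + d) *\<^sub>C f = c *\<^sub>C f + d *\<^sub>C f"
    by transfer (simp add: scaleC_add_left)
  show "c *\<^sub>C d *\<^sub>C f = (c * d) *\<^sub>C f"
    by transfer (simp add: scaleC_scaleC)
  show "1 *\<^sub>C f = f"
    by transfer (simp add: scaleC_one)
  show "r *\<^sub>R f = complex_of_real r *\<^sub>C f"
    by transfer (simp add: scaleR_scaleC)
  have le: "norm (a *\<^sub>C h) \<le> cmod a * norm h" for a and h :: "'a \<Rightarrow>\<^sub>L 'b"
    by (rule norm_blinfun_bound)
      (auto simp: scaleC_blinfun.rep_eq norm_scaleC mult.assoc intro!: mult_left_mono norm_blinfun)
  show "norm (c *\<^sub>C f) = cmod c * norm f"
  proof (cases "c = 0")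
    case True
    then show ?thesis using le[of 0 f] by simp
  next
    case False
    have "inverse c *\<^sub>C c *\<^sub>C f = f"
      using False by transfer (simp add: scaleC_scaleC scaleC_one)
    then have "norm f \<le> cmod (inverse c) * norm (c *\<^sub>C f)"
      using le[of "inverse c" "c *\<^sub>C f"] by simp
    then have "cmod c * norm f \<le> cmod c * (cmod (inverse c) * norm (c *\<^sub>C f))"
      by (rule mult_left_mono) simp
    also have "\<dots> = norm (c *\<^sub>C f)"
      using False by (simp add: norm_inverse)
    finally have "cmod c * norm f \<le> norm (c *\<^sub>C f)" .
    with le[of c f] show ?thesis by simp
  qed
qed

end

definition cadjoint :: "('a::complex_inner \<Rightarrow> 'b::complex_inner) \<Rightarrow> 'b \<Rightarrow> 'a"
  where "cadjoint A = (SOME B. \<forall>x y. cinner (A x) y = cinner x (B y))"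

definition rank_of :: "('a::complex_vector \<Rightarrow> 'b::complex_vector) \<Rightarrow> nat"
  where "rank_of A = complex_vector.dim (range A)"

text \<open>The \<open>k\<close>-th largest singular value, counted with multiplicity: singular values are the
  square roots of the eigenvalues of \<open>A\<^sup>*A\<close>, and \<open>s\<close> belongs to the set below iff \<open>k\<close>
  of them (listed by means of orthonormal eigenvectors \<open>v 0, \<dots>, v (k - 1)\<close>) are at least \<open>s\<close>.\<close>

definition singular_value :: "nat \<Rightarrow> ('a::complex_inner \<Rightarrow> 'b::complex_inner) \<Rightarrow> real"
  where "singular_value k A = Sup {s. \<exists>v t.
    (\<forall>i<k. \<forall>j<k. cinner (v i) (v j) = (if i = j then 1 else 0)) \<and>
    (\<forall>i<k. cadjoint A (A (v i)) = complex_of_real ((t i)\<^sup>2) *\<^sub>C v i) \<and>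
    0 \<le> s \<and> (\<forall>i<k. s \<le> t i)}"

definition sigma_inf :: "('a::complex_inner \<Rightarrow> 'b::complex_inner) \<Rightarrow> real"
  where "sigma_inf A = Inf {norm (A x) |x. norm x = 1}"


subsection \<open>Quasimatrices\<close>

text \<open>A quasimatrix with columns in \<open>'h\<close> is the array \<open>V :: 'h ^ 'm\<close> of its columns, with
  \<open>CARD('m)\<close> the number of columns; it acts on coefficient vectors in \<open>complex ^ 'm\<close>.\<close>

definition qmap :: "'h::complex_vector ^ 'm \<Rightarrow> complex ^ 'm \<Rightarrow> 'h"
  where "qmap V x = (\<Sum>j\<in>UNIV. x $ j *\<^sub>C V $ j)"

definition orthonormal_columns :: "'h::complex_inner ^ 'm \<Rightarrow> bool"
  where "orthonormal_columns U \<longleftrightarrow> (\<forall>i j. cinner (U $ i) (U $ j) = (if i = j then 1 else 0))"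

definition economized_svd ::
  "'h::complex_inner ^ 'n \<Rightarrow> 'h ^ 'm \<Rightarrow> complex ^ 'm ^ 'm \<Rightarrow> (complex ^ 'n) ^ 'm \<Rightarrow> bool"
  where "economized_svd A U S V \<longleftrightarrow>
    orthonormal_columns U \<and> orthonormal_columns V \<and>
    (\<forall>i j. i \<noteq> j \<longrightarrow> S $ i $ j = 0) \<and> (\<forall>i. S $ i $ i \<in> \<real> \<and> 0 \<le> Re (S $ i $ i)) \<and>
    (\<forall>x. qmap A x = qmap U (S *v cadjoint (qmap V) x))"


subsection \<open>Holomorphic functions with values in a complex normed space\<close>

definition has_cderiv :: "(complex \<Rightarrow> 'a::complex_normed_vector) \<Rightarrow> 'a \<Rightarrow> complex \<Rightarrow> bool"
  where "has_cderiv f d z \<longleftrightarrow> (f has_derivative (\<lambda>h. h *\<^sub>C d)) (at z)"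

definition cderiv :: "(complex \<Rightarrow> 'a::complex_normed_vector) \<Rightarrow> complex \<Rightarrow> 'a"
  where "cderiv f z = (THE d. has_cderiv f d z)"

text \<open>Only used on open sets.\<close>

definition cholomorphic_on :: "(complex \<Rightarrow> 'a::complex_normed_vector) \<Rightarrow> complex set \<Rightarrow> bool"
  where "cholomorphic_on f S \<longleftrightarrow> (\<forall>z\<in>S. \<exists>d. has_cderiv f d z)"


subsection \<open>Nonlinear eigenproblems\<close>

text \<open>An unbounded operator with domain \<open>D\<close> is a total function of which only the restriction
  to \<open>D\<close> matters.\<close>

definition linear_on_dom :: "'h::complex_vector set \<Rightarrow> ('h \<Rightarrow> 'h) \<Rightarrow> bool"
  where "linear_on_dom D A \<longleftrightarrow>
    (\<forall>x\<in>D. \<forall>y\<in>D. A (x + y) = A x + A y) \<and> (\<forall>c. \<forall>x\<in>D. A (c *\<^sub>C x) = c *\<^sub>C A x)"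

definition closed_operator :: "'h::complex_normed_vector set \<Rightarrow> ('h \<Rightarrow> 'h) \<Rightarrow> bool"
  where "closed_operator D A \<longleftrightarrow> closed {(x, A x) |x. x \<in> D}"

definition fredholm :: "'h::complex_normed_vector set \<Rightarrow> ('h \<Rightarrow> 'h) \<Rightarrow> bool"
  where "fredholm D A \<longleftrightarrow> closed (A ` D) \<and>
    (\<exists>B. finite B \<and> {x\<in>D. A x = 0} \<subseteq> complex_vector.span B) \<and>
    (\<exists>B. finite B \<and> (\<forall>y. \<exists>x\<in>D. y - A x \<in> complex_vector.span B))"

definition op_invertible :: "'h::complex_normed_vector set \<Rightarrow> ('h \<Rightarrow> 'h) \<Rightarrow> bool"
  where "op_invertible D A \<longleftrightarrow> bij_betw A D UNIV \<and> bounded_linear (the_inv_into D A)"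

definition nonlinear_eigenproblem ::
  "complex set \<Rightarrow> 'h::chilbert_space set \<Rightarrow> (complex \<Rightarrow> 'h \<Rightarrow> 'h) \<Rightarrow> bool"
  where "nonlinear_eigenproblem \<Omega> D T \<longleftrightarrow>
    open \<Omega> \<and> connected \<Omega> \<and> \<Omega> \<noteq> {} \<and>
    complex_vector.subspace D \<and> closure D = UNIV \<and>
    (\<forall>z\<in>\<Omega>. linear_on_dom D (T z) \<and> closed_operator D (T z) \<and> fredholm D (T z)) \<and>
    (\<forall>u\<in>D. cholomorphic_on (\<lambda>z. T z u) \<Omega>)"

definition nep_spectrum ::
  "complex set \<Rightarrow> 'h::chilbert_space set \<Rightarrow> (complex \<Rightarrow> 'h \<Rightarrow> 'h) \<Rightarrow> complex set"
  where "nep_spectrum \<Omega> D T = {z\<in>\<Omega>. \<not> op_invertible D (T z)}"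

definition nep_pseudospectrum ::
  "complex set \<Rightarrow> 'h::chilbert_space set \<Rightarrow> (complex \<Rightarrow> 'h \<Rightarrow> 'h) \<Rightarrow> real \<Rightarrow> complex set"
  where "nep_pseudospectrum \<Omega> D T \<epsilon> =
    (\<Union>E \<in> {E :: complex \<Rightarrow> 'h \<Rightarrow>\<^sub>L 'h. cholomorphic_on E \<Omega> \<and>
              (\<forall>z\<in>\<Omega>. clinear (blinfun_apply (E z))) \<and>
              bdd_above ((\<lambda>z. norm (E z)) ` \<Omega>) \<and> (SUP z\<in>\<Omega>. norm (E z)) < \<epsilon>}.
      nep_spectrum \<Omega> D (\<lambda>z x. T z x + blinfun_apply (E z) x))"

definition mat_pseudospectrum ::
  "(complex \<Rightarrow> 'a::complex_inner \<Rightarrow> 'b::complex_inner) \<Rightarrow> real \<Rightarrow> complex set"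
  where "mat_pseudospectrum F \<delta> = {z. sigma_inf (F z) < \<delta>}"


subsection \<open>Contours\<close>

definition rectifiable :: "(real \<Rightarrow> complex) \<Rightarrow> bool"
  where "rectifiable \<gamma> \<longleftrightarrow> bdd_above
    {\<Sum>K\<in>p. cmod (\<gamma> (Sup K) - \<gamma> (Inf K)) |p. p division_of {0..1::real}}"

text \<open>Riemann--Stieltjes integral along a curve; the library's contour integrals require a
  piecewise continuously differentiable path and complex valued integrands.\<close>

definition has_curve_integral ::
  "(complex \<Rightarrow> 'a::complex_normed_vector) \<Rightarrow> 'a \<Rightarrow> (real \<Rightarrow> complex) \<Rightarrow> bool"
  where "has_curve_integral f I \<gamma> \<longleftrightarrow>
    (\<forall>\<epsilon>>0. \<exists>\<delta>>0. \<forall>p. p tagged_division_of {0..1::real} \<and> (\<forall>(t, K)\<in>p. Sup K - Inf K < \<delta>) \<longrightarrow>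
      norm ((\<Sum>(t, K)\<in>p. (\<gamma> (Sup K) - \<gamma> (Inf K)) *\<^sub>C f (\<gamma> t)) - I) < \<epsilon>)"

abbreviation curve_interior :: "(real \<Rightarrow> complex) \<Rightarrow> complex set"
  where "curve_interior \<gamma> \<equiv> inside (path_image \<gamma>)"

text \<open>The curve is traversed counterclockwise, as the residue calculus with prefactor
  \<open>1 / (2 \<pi> i)\<close> presupposes.\<close>

definition admissible_contour ::
  "complex set \<Rightarrow> 'h::chilbert_space set \<Rightarrow> (complex \<Rightarrow> 'h \<Rightarrow> 'h) \<Rightarrow> (real \<Rightarrow> complex) \<Rightarrow> bool"
  where "admissible_contour \<Omega> D T \<gamma> \<longleftrightarrow>
    simple_path \<gamma> \<and> pathfinish \<gamma> = pathstart \<gamma> \<and> rectifiable \<gamma> \<and>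
    (\<forall>z\<in>curve_interior \<gamma>. winding_number \<gamma> z = 1) \<and>
    path_image \<gamma> \<subseteq> \<Omega> \<and> path_image \<gamma> \<inter> nep_spectrum \<Omega> D T = {} \<and>
    simply_connected (curve_interior \<gamma>) \<and> curve_interior \<gamma> \<subseteq> \<Omega>"


subsection \<open>Keldysh's expansion\<close>

text \<open>\<open>(cderiv ^^ j) (\<lambda>z. T z u) l\<close> is \<open>T\<^sup>(\<^sup>j\<^sup>)(l) u\<close>. A Jordan chain starts with an eigenvector.\<close>

definition right_jordan_chain ::
  "'h::chilbert_space set \<Rightarrow> (complex \<Rightarrow> 'h \<Rightarrow> 'h) \<Rightarrow> complex \<Rightarrow> 'h list \<Rightarrow> bool"
  where "right_jordan_chain D T l vs \<longleftrightarrow>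
    vs \<noteq> [] \<and> hd vs \<noteq> 0 \<and> set vs \<subseteq> D \<and>
    (\<forall>i<length vs. (\<Sum>j\<le>i. (1 / fact j) *\<^sub>C (cderiv ^^ j) (\<lambda>z. T z (vs ! (i - j))) l) = 0)"

text \<open>A Jordan chain of the adjoint family: \<open>\<Sum>j\<le>i. T\<^sup>(\<^sup>j\<^sup>)(l)\<^sup>* w\<^bsub>i-j\<^esub> / j! = 0\<close>, tested against
  the vectors of the common domain of the unbounded operators \<open>T\<^sup>(\<^sup>j\<^sup>)(l)\<close>.\<close>

definition left_jordan_chain ::
  "'h::chilbert_space set \<Rightarrow> (complex \<Rightarrow> 'h \<Rightarrow> 'h) \<Rightarrow> complex \<Rightarrow> 'h list \<Rightarrow> bool"
  where "left_jordan_chain D T l ws \<longleftrightarrow>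
    ws \<noteq> [] \<and> hd ws \<noteq> 0 \<and>
    (\<forall>i<length ws. \<forall>u\<in>D.
      (\<Sum>j\<le>i. (1 / fact j) * cinner (ws ! (i - j)) ((cderiv ^^ j) (\<lambda>z. T z u) l)) = 0)"

text \<open>A canonical system of Jordan chains at \<open>l\<close>: the leading vectors form a basis of the
  kernel of \<open>T l\<close> (they span it by the case \<open>length xs = 1\<close>), and the chains are as long as
  possible. Their lengths are the partial multiplicities of \<open>l\<close>, and the sum of the lengths is
  its algebraic multiplicity.\<close>

definition canonical_system ::
  "'h::chilbert_space set \<Rightarrow> (complex \<Rightarrow> 'h \<Rightarrow> 'h) \<Rightarrow> complex \<Rightarrow> 'h list list \<Rightarrow> bool"
  where "canonical_system D T l C \<longleftrightarrow>
    (\<forall>vs\<in>set C. right_jordan_chain D T l vs) \<and>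
    distinct (map hd C) \<and> complex_vector.independent (set (map hd C)) \<and>
    (\<forall>xs. right_jordan_chain D T l xs \<longrightarrow>
      hd xs \<in> complex_vector.span {hd vs |vs. vs \<in> set C \<and> length xs \<le> length vs})"

text \<open>\<open>bs\<close> lists the Jordan blocks of \<open>J\<close>, each given by its eigenvalue and the list of the
  indices it occupies. The type \<open>'m\<close> carries no order: \<open>concat (map snd bs)\<close> is the enumeration
  of the coordinates with respect to which \<open>J\<close> is block diagonal.\<close>

definition jordan_blocks :: "(complex \<times> 'm list) list \<Rightarrow> complex ^ 'm ^ 'm \<Rightarrow> bool"
  where "jordan_blocks bs J \<longleftrightarrow>
    distinct (concat (map snd bs)) \<and> set (concat (map snd bs)) = UNIV \<and>
    (\<forall>(l, ks)\<in>set bs. ks \<noteq> [] \<and>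
      (\<forall>a<length ks. \<forall>j. J $ (ks ! a) $ j =
        (if j = ks ! a then l else if Suc a < length ks \<and> j = ks ! Suc a then 1 else 0)))"

text \<open>With upper Jordan blocks, right chains run through a block forwards and left chains
  backwards. The canonical systems make the columns of \<open>V\<close> exhaust the algebraic multiplicities
  of the eigenvalues inside the curve; the normalization of \<open>V\<close> and \<open>W\<close> relative to each other
  is the one for which the expansion holds.\<close>

definition keldysh_expansion ::
  "complex set \<Rightarrow> 'h::chilbert_space set \<Rightarrow> (complex \<Rightarrow> 'h \<Rightarrow> 'h) \<Rightarrow> (real \<Rightarrow> complex) \<Rightarrow>
   'h ^ 'm \<Rightarrow> 'h ^ 'm \<Rightarrow> complex ^ 'm ^ 'm \<Rightarrow> (complex \<Rightarrow> 'h \<Rightarrow>\<^sub>L 'h) \<Rightarrow> bool"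
  where "keldysh_expansion \<Omega> D T \<gamma> V W J R \<longleftrightarrow>
    (\<exists>bs. jordan_blocks bs J \<and>
      fst ` set bs = nep_spectrum \<Omega> D T \<inter> curve_interior \<gamma> \<and>
      (\<forall>l\<in>fst ` set bs.
        canonical_system D T l (map (\<lambda>(_, ks). map (\<lambda>k. V $ k) ks) (filter (\<lambda>b. fst b = l) bs))) \<and>
      (\<forall>(l, ks)\<in>set bs. left_jordan_chain D T l (rev (map (\<lambda>k. W $ k) ks)))) \<and>
    (\<exists>N. open N \<and> closure (curve_interior \<gamma>) \<subseteq> N \<and> N \<subseteq> \<Omega> \<and>
      cholomorphic_on R N \<and> (\<forall>z\<in>N. clinear (blinfun_apply (R z))) \<and>
      (\<forall>z\<in>N - nep_spectrum \<Omega> D T. \<forall>h.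
        the_inv_into D (T z) h =
          qmap V (matrix_inv (mat z - J) *v cadjoint (qmap W) h) + blinfun_apply (R z) h))"

end

theory Submission
  imports Defs
begin

text \<open>
  The contour integrals evaluate to \<open>A\<^sub>0 = V W\<^sup>* \<V>\<close> and \<open>A\<^sub>1 = V J W\<^sup>* \<V>\<close>, whence
  \<open>F(z) = - V (z I - J) B\<close> with \<open>B = W\<^sup>* \<V> V\<^sub>0\<close>. The rank hypotheses make \<open>V\<close> injective and \<open>B\<close>
  invertible. So \<open>F(z)\<close> contains \<open>z I - J\<close> where Keldysh's expansion
  \<open>T(z)\<^sup>-\<^sup>1 = V (z I - J)\<^sup>-\<^sup>1 W\<^sup>* + R(z)\<close> contains its inverse, and the theorem compares the smallest
  stretching of the former with the largest stretching of the latter.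

  On the side of \<open>T\<close>, a point \<open>z\<close> of the resolvent set lies in the \<open>\<epsilon>\<close>-pseudospectrum iff
  \<open>norm (T(z)\<^sup>-\<^sup>1) > 1 / \<epsilon>\<close>. One direction is the Neumann series (\<open>pseudospectrum_resolvent_bound\<close>), the other a rank one
  perturbation (\<open>large_resolvent_in_pseudospectrum\<close>). The remainder \<open>R(z)\<close> changes the norm by at most \<open>M\<close>, which explains the terms
  \<open>M \<delta>\<close> in \<open>\<delta>1\<close> and \<open>\<delta>2\<close>. What remains are two estimates of \<open>V (z I - J)\<^sup>-\<^sup>1 W\<^sup>*\<close>. From above,
  it is \<open>- V B\<close> times the inverse of \<open>F(z)\<close> on the range of \<open>V\<close> times \<open>V W\<^sup>*\<close>
  (\<open>factored_resolvent_upper_bound\<close>). From below, an almost null vector \<open>x\<close> of \<open>F(z)\<close>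
  is pulled back to \<open>h\<close> with \<open>W\<^sup>* h = (z I - J) B x\<close>
  (\<open>factored_resolvent_lower_bound\<close>). The \<open>m\<close>-th singular values enter as the lower bounds
  of \<open>V W\<^sup>*\<close> and \<open>V W\<^sup>* \<V>\<close> on the orthogonal complements of their kernels
  (\<open>singular_value_properties\<close>). If \<open>z\<close> is an eigenvalue, both pseudospectra contain it.

  The contour is merely rectifiable. Its Stieltjes integrals are reduced to contour integrals along
  inscribed polygons (\<open>curve_integral_eq_contour_integral\<close>), which Cauchy's theorem and back
  substitution in the Jordan blocks evaluate (\<open>jordan_resolvent_integral\<close>, \<open>keldysh_moments\<close>).
\<close>

\<comment> \<open>\<open>$\<close> is reserved for vector components.\<close>
unbundle no fps_syntax

section \<open>Complex inner products and quasimatrices\<close>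

lemma clinearI:
  assumes "\<And>x y. f (x + y) = f x + f y" "\<And>c x. f (c *\<^sub>C x) = c *\<^sub>C f x"
  shows "clinear f"
  by unfold_locales (simp_all add: assms)

lemma
  assumes "clinear f"
  shows clinear_add: "f (x + y) = f x + f y"
    and clinear_scaleC: "f (c *\<^sub>C x) = c *\<^sub>C f x"
    and clinear_zero: "f 0 = 0"
    and clinear_diff: "f (x - y) = f x - f y"
    and clinear_sum: "f (sum g S) = (\<Sum>i\<in>S. f (g i))"
proof -
  interpret Vector_Spaces.linear scaleC scaleC f by fact
  show "f (x + y) = f x + f y" "f (c *\<^sub>C x) = c *\<^sub>C f x" "f 0 = 0" "f (x - y) = f x - f y"
    "f (sum g S) = (\<Sum>i\<in>S. f (g i))"
    by (rule add scale zero diff sum)+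
qed

lemma clinear_compose: "clinear f \<Longrightarrow> clinear g \<Longrightarrow> clinear (\<lambda>x. f (g x))"
  by (rule clinearI) (simp_all add: clinear_add clinear_scaleC)

lemma clinear_inj_iff: "clinear f \<Longrightarrow> inj f \<longleftrightarrow> (\<forall>x. f x = 0 \<longrightarrow> x = 0)"
  by (metis clinear_diff clinear_zero eq_iff_diff_eq_0 inj_def)

lemma clinear_imp_linear: "clinear f \<Longrightarrow> linear f"
  by (intro linearI) (simp_all add: clinear_add clinear_scaleC scaleR_scaleC)

lemma cinner_add_left: "cinner (x + y) z = cinner x z + cinner y z"
  by (metis cinner_add_right cinner_commute complex_cnj_add)

lemma cinner_scaleC_left: "cinner (c *\<^sub>C x) y = cnj c * cinner x y"
  by (metis cinner_commute cinner_scaleC_right complex_cnj_mult)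

lemma clinear_cinner_right: "clinear (cinner x)"
  by (rule clinearI) (simp_all add: cinner_add_right cinner_scaleC_right scaleC_complex_def)

lemmas cinner_zero_right = clinear_zero[OF clinear_cinner_right]
  and cinner_diff_right = clinear_diff[OF clinear_cinner_right]
  and cinner_sum_right = clinear_sum[OF clinear_cinner_right]

lemma cinner_zero_left: "cinner 0 x = 0"
  by (metis cinner_commute cinner_zero_right complex_cnj_zero)

lemma cinner_sum_left: "cinner (sum g S) x = (\<Sum>i\<in>S. cinner (g i) x)"
  by (induction S rule: infinite_finite_induct) (simp_all add: cinner_add_left cinner_zero_left)

lemma cinner_eq_zero_iff: "cinner x x = 0 \<longleftrightarrow> x = 0"
  by (simp add: cinner_self)

lemma cinner_ext:
  assumes "\<And>w. cinner w x = cinner w y" shows "x = y"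
  using assms[of "x - y"] by (metis cinner_diff_right cinner_eq_zero_iff eq_iff_diff_eq_0)

lemma pythagoras:
  assumes "cinner x y = 0" shows "(norm (x + y))\<^sup>2 = (norm x)\<^sup>2 + (norm y)\<^sup>2"
proof -
  have "cinner y x = 0" using assms by (metis cinner_commute complex_cnj_zero)
  then have "cinner (x + y) (x + y) = cinner x x + cinner y y"
    using assms by (simp add: cinner_add_left cinner_add_right)
  then show ?thesis unfolding cinner_self by (metis of_real_add of_real_eq_iff)
qed

lemma cinner_cauchy_schwarz: "cmod (cinner y x) \<le> norm y * norm x"
proof (cases "y = 0")
  case False
  define c where "c = cinner y x / complex_of_real ((norm y)\<^sup>2)"
  have "cinner y (x - c *\<^sub>C y) = 0"
    using False by (simp add: cinner_diff_right cinner_scaleC_right cinner_self c_def)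
  then have "cinner (c *\<^sub>C y) (x - c *\<^sub>C y) = 0" by (simp add: cinner_scaleC_left)
  from pythagoras[OF this] have "(norm (c *\<^sub>C y))\<^sup>2 \<le> (norm x)\<^sup>2" by simp
  then have "cmod c * norm y \<le> norm x" by (simp add: norm_scaleC)
  moreover have "cmod c = cmod (cinner y x) / (norm y)\<^sup>2"
    by (simp add: c_def norm_divide norm_power)
  ultimately show ?thesis using False by (simp add: field_simps power2_eq_square)
qed (simp add: cinner_zero_left)

text \<open>The adjoint is a choice among all maps satisfying the adjoint identity; as the inner product
  is nondegenerate there is at most one of them, so that exhibiting one computes it.\<close>

lemma cadjoint_eq:
  assumes "\<And>x y. cinner (A x) y = cinner x (B y)" shows "cadjoint A = B"
proof -
  have "\<forall>x y. cinner (A x) y = cinner x (cadjoint A y)"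
    unfolding cadjoint_def by (rule someI[of "\<lambda>B. \<forall>x y. cinner (A x) y = cinner x (B y)" B]) (use assms in blast)
  with assms show ?thesis by (metis cinner_ext ext)
qed

lemma clinear_qmap: "clinear (qmap V)"
  by (rule clinearI)
    (simp_all add: qmap_def scaleC_vec_def scaleC_add_left sum.distrib complex_vector.scale_sum_right
      scaleC_complex_def scaleC_scaleC)

lemma clinear_eq_qmap:
  fixes f :: "complex ^ 'm \<Rightarrow> 'h::complex_vector"
  assumes "clinear f" shows "f = qmap (\<chi> j. f (axis j 1))"
proof
  fix x :: "complex ^ 'm"
  have "x = (\<Sum>j\<in>UNIV. x $ j *\<^sub>C axis j 1)"
    by (simp add: vec_eq_iff scaleC_vec_def scaleC_complex_def axis_def if_distrib[of "\<lambda>y. _ * y"] cong: if_cong)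
  then have "f x = f (\<Sum>j\<in>UNIV. x $ j *\<^sub>C axis j 1)" by simp
  then show "f x = qmap (\<chi> j. f (axis j 1)) x"
    by (simp add: qmap_def clinear_sum[OF assms] clinear_scaleC[OF assms])
qed

lemma bounded_linear_qmap: "bounded_linear (qmap (V :: 'h::complex_normed_vector ^ 'm))"
proof (rule bounded_linear_intro[where K = "\<Sum>j\<in>UNIV. norm (V $ j)"])
  fix x y :: "complex ^ 'm" and r :: real
  show "qmap V (x + y) = qmap V x + qmap V y" by (rule clinear_add[OF clinear_qmap])
  show "qmap V (r *\<^sub>R x) = r *\<^sub>R qmap V x"
    by (simp add: scaleR_scaleC clinear_scaleC[OF clinear_qmap])
  have "norm (qmap V x) \<le> (\<Sum>j\<in>UNIV. norm (x $ j *\<^sub>C V $ j))"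
    unfolding qmap_def by (rule norm_sum)
  also have "\<dots> \<le> (\<Sum>j\<in>UNIV. norm x * norm (V $ j))"
    by (intro sum_mono) (simp add: norm_scaleC mult_right_mono component_le_norm_cart Finite_Cartesian_Product.norm_nth_le)
  finally show "norm (qmap V x) \<le> norm x * (\<Sum>j\<in>UNIV. norm (V $ j))"
    by (simp add: sum_distrib_left)
qed

lemma clinear_imp_bounded_linear:
  fixes f :: "complex ^ 'm \<Rightarrow> 'h::complex_normed_vector"
  assumes "clinear f" shows "bounded_linear f"
  by (subst clinear_eq_qmap[OF assms]) (rule bounded_linear_qmap)

lemma cinner_qmap: "cinner (qmap V x) h = cinner x (\<chi> j. cinner (V $ j) h)"
  by (simp add: qmap_def cinner_sum_left cinner_scaleC_left cinner_vec_def cinner_complex_def)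

lemma cadjoint_qmap: "cadjoint (qmap W) h = (\<chi> j. cinner (W $ j) h)"
  by (simp add: cadjoint_eq[OF cinner_qmap])

lemma cinner_cadjoint_qmap: "cinner (qmap V x) h = cinner x (cadjoint (qmap V) h)"
  by (simp add: cinner_qmap cadjoint_qmap)

lemma cinner_cadjoint_qmap': "cinner (cadjoint (qmap V) h) x = cinner h (qmap V x)"
  by (metis cinner_cadjoint_qmap cinner_commute)

lemma clinear_cadjoint_qmap: "clinear (cadjoint (qmap W))"
  by (rule clinearI)
    (simp_all add: cadjoint_qmap vec_eq_iff cinner_add_right cinner_scaleC_right scaleC_vec_def scaleC_complex_def)

lemma bounded_linear_cadjoint_qmap:
  "bounded_linear (cadjoint (qmap (W :: 'h::complex_inner ^ 'm)))"
proof (rule bounded_linear_intro[where K = "\<Sum>j\<in>UNIV. norm (W $ j)"])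
  fix x y :: 'h and r :: real
  show "cadjoint (qmap W) (x + y) = cadjoint (qmap W) x + cadjoint (qmap W) y"
    by (rule clinear_add[OF clinear_cadjoint_qmap])
  show "cadjoint (qmap W) (r *\<^sub>R x) = r *\<^sub>R cadjoint (qmap W) x"
    by (simp add: scaleR_scaleC clinear_scaleC[OF clinear_cadjoint_qmap])
  have "norm (cadjoint (qmap W) x) \<le> (\<Sum>j\<in>UNIV. cmod (cinner (W $ j) x))"
    by (simp add: norm_vec_def L2_set_le_sum cadjoint_qmap)
  also have "\<dots> \<le> (\<Sum>j\<in>UNIV. norm (W $ j) * norm x)"
    by (intro sum_mono cinner_cauchy_schwarz)
  finally show "norm (cadjoint (qmap W) x) \<le> norm x * (\<Sum>j\<in>UNIV. norm (W $ j))"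
    by (simp add: sum_distrib_left mult.commute)
qed

lemma cadjoint_qmap_orthonormal:
  assumes "orthonormal_columns U" shows "cadjoint (qmap U) (qmap U x) = x"
  using assms
  by (simp add: vec_eq_iff cadjoint_qmap orthonormal_columns_def qmap_def cinner_sum_right
      cinner_scaleC_right if_distrib[of "\<lambda>y. _ * y"] cong: if_cong)

lemma norm_qmap_orthonormal:
  assumes "orthonormal_columns U" shows "norm (qmap U x) = norm x"
proof -
  have "cinner (qmap U x) (qmap U x) = cinner x x"
    by (simp add: cinner_cadjoint_qmap cadjoint_qmap_orthonormal[OF assms])
  then have "(norm (qmap U x))\<^sup>2 = (norm x)\<^sup>2" unfolding cinner_self of_real_eq_iff .
  then show ?thesis by simp
qed

text \<open>The adjoint \<open>V S\<^sup>* U\<^sup>*\<close> of the decomposed operator; what matters later is that it maps into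
  the range of \<open>V\<close>.\<close>

lemma economized_svd_adjoint:
  assumes svd: "economized_svd A U S V"
  obtains H where "clinear H"
    "\<And>x y. cinner (qmap A x) y = cinner x (qmap V (H (cadjoint (qmap U) y)))"
proof -
  define H where "H = (\<lambda>x. \<chi> i. cnj (S $ i $ i) * x $ i)"
  have S: "S *v x = (\<chi> i. S $ i $ i * x $ i)" for x
  proof -
    have "(\<Sum>j\<in>UNIV. S $ i $ j * x $ j) = (\<Sum>j\<in>UNIV. if j = i then S $ i $ i * x $ i else 0)" for i
      using svd by (intro sum.cong) (auto simp: economized_svd_def)
    then show ?thesis by (simp add: matrix_vector_mult_def)
  qed
  have "clinear H"
    by (rule clinearI) (simp_all add: H_def vec_eq_iff scaleC_vec_def scaleC_complex_def algebra_simps)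
  moreover have "cinner (qmap A x) y = cinner x (qmap V (H (cadjoint (qmap U) y)))" for x y
  proof -
    have "qmap A x = qmap U (S *v cadjoint (qmap V) x)"
      using svd unfolding economized_svd_def by blast
    then have "cinner (qmap A x) y = cinner (S *v cadjoint (qmap V) x) (cadjoint (qmap U) y)"
      by (simp add: cinner_cadjoint_qmap)
    also have "\<dots> = cinner (cadjoint (qmap V) x) (H (cadjoint (qmap U) y))"
      by (simp add: S H_def cinner_vec_def cinner_complex_def mult_ac)
    finally show ?thesis by (simp add: cinner_cadjoint_qmap')
  qed
  ultimately show ?thesis using that by blast
qed

lemma clinear_inj_imp_surj:
  fixes f :: "complex ^ 'm \<Rightarrow> complex ^ 'm"
  assumes "clinear f" "inj f" shows "surj f"
  using eucl.linear_inj_imp_surj[OF clinear_imp_linear[OF assms(1)] assms(2)] .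

lemma clinear_surj_imp_inj:
  fixes f :: "complex ^ 'm \<Rightarrow> complex ^ 'm"
  assumes "clinear f" "surj f" shows "inj f"
  using eucl.linear_surj_imp_inj[OF clinear_imp_linear[OF assms(1)] assms(2)] .

text \<open>A basis of the range, lifted to the domain: rank \<open>m\<close> provides an \<open>m\<close>-dimensional
  coordinate space on which the map is injective. Rank hypotheses are useful in this form,
  because injective endomorphisms of \<open>complex ^ 'm\<close> are surjective.\<close>

lemma rank_of_eq_CARD:
  fixes f :: "'a::complex_vector \<Rightarrow> 'b::complex_vector"
  assumes f: "clinear f" and r: "rank_of f = CARD('m::finite)"
  obtains P :: "complex ^ 'm \<Rightarrow> 'a" where "clinear P" "inj (\<lambda>x. f (P x))"
proof -
  obtain B where B: "B \<subseteq> range f" "complex_vector.independent B" "card B = CARD('m)"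
    using complex_vector.basis_exists[of "range f"] r unfolding rank_of_def by metis
  have fin: "finite B" using B(3) by (metis card.infinite zero_less_card_finite less_irrefl)
  obtain e :: "'m \<Rightarrow> 'b" where e: "bij_betw e UNIV B"
    using finite_same_card_bij[OF finite_class.finite_UNIV fin] B(3) by auto
  define a where "a j = (SOME x. f x = e j)" for j
  have a: "f (a j) = e j" for j
  proof -
    have "e j \<in> range f" using e B(1) bij_betwE by blast
    then show ?thesis unfolding a_def by (metis (mono_tags, lifting) someI_ex imageE)
  qed
  define P where "P = qmap (\<chi> j. a j)"
  have P: "clinear P" unfolding P_def by (rule clinear_qmap)
  have fP: "f (P x) = (\<Sum>j\<in>UNIV. x $ j *\<^sub>C e j)" for x
    by (simp add: P_def qmap_def clinear_sum[OF f] clinear_scaleC[OF f] a)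
  have "x = 0" if "f (P x) = 0" for x
  proof -
    have inje: "inj e" using e bij_betw_imp_inj_on by blast
    have rng: "range e = B" using e bij_betw_imp_surj_on by blast
    have "(\<Sum>b\<in>B. x $ (inv e b) *\<^sub>C b) = (\<Sum>j\<in>UNIV. x $ j *\<^sub>C e j)"
      using sum.reindex[OF inje, of "\<lambda>b. x $ (inv e b) *\<^sub>C b"] by (simp add: rng inje)
    then have "(\<Sum>b\<in>B. x $ (inv e b) *\<^sub>C b) = 0" using that fP by simp
    then have "x $ (inv e b) = 0" if "b \<in> B" for b
      using complex_vector.independentD[OF B(2) fin subset_refl _ that, of "\<lambda>b. x $ (inv e b)"] by simp
    then have "x $ j = 0" for j by (metis inje inv_f_f rng rangeI)
    then show "x = 0" by (simp add: vec_eq_iff)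
  qed
  then have "inj (\<lambda>x. f (P x))" using clinear_inj_iff[OF clinear_compose[OF f P]] by blast
  with P that show ?thesis by blast
qed

text \<open>Lifting a basis of the range of the product gives an injective, hence bijective, endomorphism
  \<open>g \<circ> P\<close> of the middle space, on which \<open>f\<close> is still injective.\<close>

lemma full_rank_factorization:
  fixes f :: "complex ^ 'm \<Rightarrow> 'b::complex_vector" and g :: "'a::complex_vector \<Rightarrow> complex ^ 'm"
  assumes f: "clinear f" and g: "clinear g" and r: "rank_of (\<lambda>x. f (g x)) = CARD('m)"
  shows "inj f" "surj g"
proof -
  obtain P :: "complex ^ 'm \<Rightarrow> 'a" where P: "clinear P" "inj (\<lambda>x. f (g (P x)))"
    using rank_of_eq_CARD[OF clinear_compose[OF f g] r] .
  then have "inj (\<lambda>x. g (P x))" by (auto simp: inj_def)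
  then have s: "surj (\<lambda>x. g (P x))" by (rule clinear_inj_imp_surj[OF clinear_compose[OF g P(1)]])
  have "\<exists>x. y = g x" for y using surjD[OF s, of y] by blast
  then show "surj g" unfolding surj_def by simp
  show "inj f"
  proof (rule injI)
    fix x y assume "f x = f y"
    moreover obtain u v where "x = g (P u)" "y = g (P v)" using surjD[OF s, of x] surjD[OF s, of y] by blast
    ultimately show "x = y" using P(2) by (auto simp: inj_def)
  qed
qed

section \<open>Singular values of a finite rank operator\<close>

text \<open>Compactness of the unit sphere of the coordinate space.\<close>

lemma clinear_inj_bounded_below:
  fixes W :: "complex ^ 'm \<Rightarrow> 'h::complex_normed_vector"
  assumes W: "clinear W" and inj: "inj W"
  obtains a where "a > 0" "\<And>c. a * norm c \<le> norm (W c)"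
proof -
  have cont: "continuous_on (sphere 0 1) (\<lambda>c. norm (W c))"
    using linear_continuous_on[OF clinear_imp_bounded_linear[OF W]] by (rule continuous_on_norm)
  have "axis undefined 1 \<in> sphere (0 :: complex ^ 'm) 1" by (simp add: norm_axis_1)
  then obtain u where u: "u \<in> sphere 0 1" "\<And>c. c \<in> sphere 0 1 \<Longrightarrow> norm (W u) \<le> norm (W c)"
    using continuous_attains_inf[OF compact_sphere _ cont] by blast
  have "W u \<noteq> 0" using u(1) inj W by (auto simp: clinear_inj_iff)
  moreover have "norm (W u) * norm c \<le> norm (W c)" for c
  proof (cases "c = 0")
    case False
    have "norm (W u) \<le> norm (W ((1 / norm c) *\<^sub>R c))" using False by (intro u(2)) simp
    also have "\<dots> = norm (W c) / norm c"
      by (simp add: scaleR_scaleC clinear_scaleC[OF W] norm_scaleC norm_divide)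
    finally show ?thesis using False by (simp add: field_simps)
  qed simp
  ultimately show ?thesis using that[of "norm (W u)"] by simp
qed

text \<open>First variation: if a unit vector \<open>u\<close> maximizes \<open>norm (A x)\<close> over unit vectors \<open>x\<close> in the
  directions \<open>u + \<tau> w\<close> with \<open>w\<close> orthogonal to \<open>u\<close>, then the linear term of \<open>norm (A (u + \<tau> w))\<^sup>2\<close>
  in \<open>\<tau>\<close> has to vanish, because the constraint changes only to second order.\<close>

lemma maximizer_orthogonality:
  assumes A: "clinear A"
    and le: "\<And>\<tau>. (norm (A (u + \<tau> *\<^sub>C w)))\<^sup>2 \<le> (norm (A u))\<^sup>2 * (norm (u + \<tau> *\<^sub>C w))\<^sup>2"
    and u: "norm u = 1" and uw: "cinner u w = 0"
  shows "cinner (A u) (A w) = 0"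
proof (rule ccontr)
  define g where "g = cinner (A u) (A w)"
  assume "cinner (A u) (A w) \<noteq> 0"
  then have g: "g \<noteq> 0" by (simp add: g_def)
  define l where "l = (norm (A u))\<^sup>2 * (norm w)\<^sup>2"
  have l: "l \<ge> 0" by (simp add: l_def)
  \<comment> \<open>A step so short that the quadratic term, of size at most \<open>r\<^sup>2 l |g|\<^sup>2\<close>, cannot compensate
    the linear term \<open>2 r |g|\<^sup>2\<close>; the phase of \<open>\<tau>\<close> makes the linear term positive.\<close>
  define r where "r = 1 / (l + 1)"
  have r: "r > 0" "r * l < 1" using l by (simp_all add: r_def)
  define \<tau> where "\<tau> = complex_of_real r * cnj g"
  have "(norm (u + \<tau> *\<^sub>C w))\<^sup>2 = 1 + r\<^sup>2 * (cmod g)\<^sup>2 * (norm w)\<^sup>2"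
    using pythagoras[of u "\<tau> *\<^sub>C w"] u uw
    by (simp add: cinner_scaleC_right norm_scaleC \<tau>_def norm_mult power_mult_distrib)
  then have "(norm (A (u + \<tau> *\<^sub>C w)))\<^sup>2 \<le> (norm (A u))\<^sup>2 + r\<^sup>2 * (cmod g)\<^sup>2 * l"
    using le[of \<tau>] by (simp add: l_def algebra_simps)
  moreover have "(norm (A (u + \<tau> *\<^sub>C w)))\<^sup>2
      = (norm (A u))\<^sup>2 + 2 * r * (cmod g)\<^sup>2 + (norm (\<tau> *\<^sub>C A w))\<^sup>2"
  proof -
    have "complex_of_real ((norm (A (u + \<tau> *\<^sub>C w)))\<^sup>2)
        = cinner (A u + \<tau> *\<^sub>C A w) (A u + \<tau> *\<^sub>C A w)"
      by (simp add: cinner_self clinear_add[OF A] clinear_scaleC[OF A])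
    also have "\<dots> = cinner (A u) (A u) + \<tau> * g + cnj (\<tau> * g) + cinner (\<tau> *\<^sub>C A w) (\<tau> *\<^sub>C A w)"
      by (simp add: cinner_add_left cinner_add_right cinner_scaleC_left cinner_scaleC_right g_def
          cinner_commute[of "A w" "A u"] algebra_simps)
    also have "\<tau> * g = complex_of_real (r * (cmod g)\<^sup>2)"
      using complex_norm_square[of g] by (simp add: \<tau>_def mult_ac)
    finally have "complex_of_real ((norm (A (u + \<tau> *\<^sub>C w)))\<^sup>2) =
        complex_of_real ((norm (A u))\<^sup>2 + 2 * r * (cmod g)\<^sup>2 + (norm (\<tau> *\<^sub>C A w))\<^sup>2)"
      by (simp add: cinner_self algebra_simps)
    then show ?thesis unfolding of_real_eq_iff .
  qed
  ultimately have "2 * r * (cmod g)\<^sup>2 \<le> r\<^sup>2 * (cmod g)\<^sup>2 * l"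
    using zero_le_power2[of "norm (\<tau> *\<^sub>C A w)"] by linarith
  then have "2 * (r * (cmod g)\<^sup>2) \<le> (r * l) * (r * (cmod g)\<^sup>2)"
    by (simp add: power2_eq_square algebra_simps)
  moreover have "r * (cmod g)\<^sup>2 > 0" using r g by simp
  ultimately have "2 \<le> r * l" by (simp add: mult_le_cancel_right)
  with r show False by simp
qed

text \<open>The spectral theorem for \<open>A\<^sup>* A\<close> on a finite-dimensional subspace, parametrized by the injective
  map \<open>W\<close>, that contains the range of \<open>A\<^sup>* = B\<close>. The next eigenvector is a maximizer of
  \<open>norm (A x)\<close> on the unit sphere of the orthogonal complement of the previous ones. Without this
  existence statement the supremum that defines the singular value could be taken over the
  empty set.\<close>

lemma orthonormal_eigenvectors:
  fixes A :: "'h::complex_inner \<Rightarrow> 'k::complex_inner" and W :: "complex ^ 'm \<Rightarrow> 'h"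
  assumes A: "clinear A" and adj: "\<And>x y. cinner (A x) y = cinner x (B y)"
    and W: "clinear W" "inj W" and AW: "inj (\<lambda>c. A (W c))" and rng: "\<And>y. B y \<in> range W"
    and k: "k \<le> CARD('m)"
  shows "\<exists>v t. (\<forall>i<k. \<forall>j<k. cinner (v i) (v j) = (if i = j then 1 else 0)) \<and>
    (\<forall>i<k. B (A (v i)) = complex_of_real ((t i)\<^sup>2) *\<^sub>C v i) \<and> (\<forall>i<k. (0::real) < t i)"
  using k
proof (induction k)
  case 0
  show ?case by simp
next
  case (Suc k)
  then obtain v t where on: "\<And>i j. i < k \<Longrightarrow> j < k \<Longrightarrow> cinner (v i) (v j) = (if i = j then 1 else 0)"
    and ev: "\<And>i. i < k \<Longrightarrow> B (A (v i)) = complex_of_real ((t i)\<^sup>2) *\<^sub>C v i"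
    and t: "\<And>i. i < k \<Longrightarrow> (0::real) < t i" by auto
  have bW: "bounded_linear W" and bAW: "bounded_linear (\<lambda>c. A (W c))"
    using clinear_imp_bounded_linear W(1) clinear_compose[OF A W(1)] by blast+
  obtain a where a: "a > 0" "\<And>c. a * norm c \<le> norm (W c)"
    using clinear_inj_bounded_below[OF W] by blast
  define K where "K = {c. norm (W c) = 1 \<and> (\<forall>i<k. cinner (v i) (W c) = 0)}"
  have clin_vi: "clinear (\<lambda>c. cinner (v i) (W c))" for i
    by (rule clinear_compose[OF clinear_cinner_right W(1)])
  have "compact K"
  proof -
    have "closed ({c. norm (W c) = 1} \<inter> (\<Inter>i\<in>{..<k}. {c. cinner (v i) (W c) = 0}))"
      using linear_continuous_on[OF bW] linear_continuous_on[OF clinear_imp_bounded_linear[OF clin_vi]]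
      by (intro closed_Int closed_INT ballI closed_Collect_eq continuous_intros)
    also have "{c. norm (W c) = 1} \<inter> (\<Inter>i\<in>{..<k}. {c. cinner (v i) (W c) = 0}) = K"
      by (auto simp: K_def)
    finally have "closed K" .
    moreover have "norm c \<le> 1 / a" if "c \<in> K" for c
      using a(2)[of c] a(1) that by (simp add: K_def field_simps)
    then have "bounded K" by (auto simp: bounded_iff)
    ultimately show ?thesis by (simp add: compact_eq_bounded_closed)
  qed
  \<comment> \<open>Fewer than \<open>CARD('m)\<close> linear conditions, padded by zeros to an endomorphism \<open>f\<close> of
    \<open>complex ^ 'm\<close> that misses the coordinate \<open>j0\<close>, have a nontrivial common solution.\<close>
  moreover have "K \<noteq> {}"
  proof -
    obtain e :: "'m \<Rightarrow> nat" where e: "bij_betw e UNIV {0..<CARD('m)}"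
      using ex_bij_betw_finite_nat[OF finite_class.finite_UNIV] by blast
    define f :: "complex ^ 'm \<Rightarrow> complex ^ 'm"
      where "f c = (\<chi> j. if e j < k then cinner (v (e j)) (W c) else 0)" for c
    have f: "clinear f"
    proof (rule clinearI)
      show "f (x + y) = f x + f y" for x y
        by (simp add: f_def vec_eq_iff clinear_add[OF W(1)] cinner_add_right)
      have "f (z *\<^sub>C x) = (\<chi> j. if e j < k then z * cinner (v (e j)) (W x) else 0)" for z x
        unfolding f_def clinear_scaleC[OF W(1)] cinner_scaleC_right ..
      then show "f (z *\<^sub>C x) = z *\<^sub>C f x" for z x
        by (simp add: f_def vec_eq_iff scaleC_vec_def scaleC_complex_def)
    qed
    have ex: "\<exists>j. e j = i" if "i < CARD('m)" for i
    proof -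
      have "i \<in> range e" using bij_betw_imp_surj_on[OF e] that by simp
      then show ?thesis by blast
    qed
    then obtain j0 where j0: "e j0 = k" using Suc.prems by (meson Suc_le_lessD)
    have "\<not> surj f"
    proof
      assume "surj f"
      then obtain c where "axis j0 1 = f c" by (rule surjE)
      then have "axis j0 1 $ j0 = f c $ j0" by simp
      then show False by (simp add: f_def j0)
    qed
    then have "\<not> inj f" using clinear_inj_imp_surj[OF f] by blast
    then obtain c where c: "c \<noteq> 0" "f c = 0" using clinear_inj_iff[OF f] by blast
    have c0: "cinner (v i) (W c) = 0" if "i < k" for i
    proof -
      obtain j where "e j = i"
        using ex[of i] Suc.prems \<open>i < k\<close> by auto
      then have "f c $ j = cinner (v i) (W c)" using that by (simp add: f_def)
      with c(2) show ?thesis by simp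
    qed
    have nz: "norm (W c) \<noteq> 0" using c(1) W by (auto simp: clinear_inj_iff)
    have "complex_of_real (1 / norm (W c)) *\<^sub>C c \<in> K"
      using nz c0 by (simp add: K_def clinear_scaleC[OF W(1)] norm_scaleC cinner_scaleC_right norm_divide)
    then show ?thesis by blast
  qed
  moreover have "continuous_on K (\<lambda>c. norm (A (W c)))"
    using linear_continuous_on[OF bAW] by (rule continuous_on_norm)
  ultimately obtain c0 where c0: "c0 \<in> K" and mx: "\<And>c. c \<in> K \<Longrightarrow> norm (A (W c)) \<le> norm (A (W c0))"
    using continuous_attains_sup by metis
  define u where "u = W c0"
  define l where "l = (norm (A u))\<^sup>2"
  have u: "norm u = 1" "\<And>i. i < k \<Longrightarrow> cinner (v i) u = 0" using c0 by (auto simp: K_def u_def)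
  have uv: "cinner u (v i) = 0" if "i < k" for i
    using u(2)[OF that] by (metis cinner_commute complex_cnj_zero)
  have le: "(norm (A x))\<^sup>2 \<le> l * (norm x)\<^sup>2" if x: "x \<in> range W" "\<And>i. i < k \<Longrightarrow> cinner (v i) x = 0" for x
  proof (cases "x = 0")
    case False
    obtain c where c: "x = W c" using x(1) by blast
    have "complex_of_real (1 / norm x) *\<^sub>C c \<in> K"
      using False x(2) by (simp add: K_def clinear_scaleC[OF W(1)] norm_scaleC cinner_scaleC_right norm_divide flip: c)
    from mx[OF this] have "norm (A x) / norm x \<le> norm (A u)"
      by (simp add: clinear_scaleC[OF W(1)] clinear_scaleC[OF A] norm_scaleC norm_divide u_def flip: c)
    then have "norm (A x) \<le> norm (A u) * norm x" using False by (simp add: field_simps)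
    then have "(norm (A x))\<^sup>2 \<le> (norm (A u) * norm x)\<^sup>2" by (simp add: power_mono)
    then show ?thesis by (simp add: l_def power_mult_distrib)
  qed (simp add: clinear_zero[OF A])
  have Wsub: "W c + \<tau> *\<^sub>C W d \<in> range W" for c d \<tau>
    by (metis W(1) clinear_add clinear_scaleC rangeI)
  \<comment> \<open>The part of \<open>B (A u)\<close> orthogonal to \<open>u\<close>; it is an admissible direction of variation, and
    the first variation in this direction is its squared norm.\<close>
  define w where "w = B (A u) - complex_of_real l *\<^sub>C u"
  obtain d where d: "B (A u) = W d" using rng by blast
  have wr: "w \<in> range W"
  proof -
    have "w = W d + (- complex_of_real l) *\<^sub>C W c0" unfolding w_def d unfolding u_def by simp
    then show ?thesis by (simp only: Wsub)
  qed
  have vi: "cinner (v i) w = 0" if "i < k" for i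
  proof -
    have "cinner (A u) (A (v i)) = 0"
      using that by (simp add: adj ev cinner_scaleC_right uv)
    then have "cinner (A (v i)) (A u) = 0" by (metis cinner_commute complex_cnj_zero)
    then show ?thesis using that by (simp add: w_def cinner_diff_right cinner_scaleC_right u adj)
  qed
  have uu: "cinner u u = 1" "cinner (A u) (A u) = complex_of_real l" by (simp_all add: cinner_self u l_def)
  have uw: "cinner u w = 0"
    by (simp add: w_def cinner_diff_right cinner_scaleC_right uu flip: adj)
  have "cinner (A u) (A w) = 0"
  proof (rule maximizer_orthogonality[OF A _ u(1) uw])
    fix \<tau>
    obtain d' where "w = W d'" using wr by blast
    then have "u + \<tau> *\<^sub>C w \<in> range W" unfolding u_def by (simp add: Wsub)
    then show "(norm (A (u + \<tau> *\<^sub>C w)))\<^sup>2 \<le> (norm (A u))\<^sup>2 * (norm (u + \<tau> *\<^sub>C w))\<^sup>2"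
      unfolding l_def[symmetric] by (rule le) (simp add: cinner_add_right cinner_scaleC_right u vi)
  qed
  then have "cinner (A w) (A u) = 0" by (metis cinner_commute complex_cnj_zero)
  moreover have "cinner w u = 0" using uw by (metis cinner_commute complex_cnj_zero)
  moreover have "cinner w w = cinner (A w) (A u) - complex_of_real l * cinner w u"
    by (subst (2) w_def) (simp add: cinner_diff_right cinner_scaleC_right adj)
  ultimately have "w = 0" using cinner_eq_zero_iff[of w] by simp
  then have evu: "B (A u) = complex_of_real ((norm (A u))\<^sup>2) *\<^sub>C u" by (simp add: w_def l_def)
  have "A u \<noteq> 0"
  proof
    assume "A u = 0"
    then have "c0 = 0" using AW clinear_inj_iff[OF clinear_compose[OF A W(1)]] by (simp add: u_def)
    with u(1) show False by (simp add: u_def clinear_zero[OF W(1)])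
  qed
  then have tu: "0 < norm (A u)" by simp
  define v' where "v' = v(k := u)"
  define t' where "t' = t(k := norm (A u))"
  have old: "v' i = v i" "t' i = t i" if "i < k" for i using that by (simp_all add: v'_def t'_def)
  have new: "v' k = u" "t' k = norm (A u)" by (simp_all add: v'_def t'_def)
  have "cinner (v' i) (v' j) = (if i = j then 1 else 0)" if "i < Suc k" "j < Suc k" for i j
    using that on[of i j] u(2)[of i] uv[of j] uu(1) old[of i] old[of j] new
    by (cases "i = k"; cases "j = k") simp_all
  moreover have "B (A (v' i)) = complex_of_real ((t' i)\<^sup>2) *\<^sub>C v' i \<and> 0 < t' i" if "i < Suc k" for i
  proof (cases "i = k")
    case True
    then show ?thesis by (simp only: new evu tu simp_thms)
  next
    case False
    then have "i < k" using that by simp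
    then show ?thesis by (simp only: old ev t simp_thms)
  qed
  ultimately show ?case by blast
qed

text \<open>Eigenvectors for nonzero eigenvalues lie in the range of \<open>B\<close>, hence of \<open>W\<close>; there are as many of
  them as coordinates, so they span the range of \<open>W\<close>, and on their span \<open>A\<close> stretches every
  component by at least \<open>s\<close>.\<close>

lemma eigenvalue_lower_bound:
  fixes A :: "'h::complex_inner \<Rightarrow> 'k::complex_inner" and W :: "complex ^ 'm \<Rightarrow> 'h"
  assumes A: "clinear A" and B: "clinear B" and adj: "\<And>x y. cinner (A x) y = cinner x (B y)"
    and W: "clinear W" and rng: "\<And>y. B y \<in> range W"
    and on: "\<And>i j. i < CARD('m) \<Longrightarrow> j < CARD('m) \<Longrightarrow> cinner (v i) (v j) = (if i = j then 1 else 0)"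
    and ev: "\<And>i. i < CARD('m) \<Longrightarrow> B (A (v i)) = complex_of_real ((t i)\<^sup>2) *\<^sub>C v i"
    and s: "0 < s" "\<And>i. i < CARD('m) \<Longrightarrow> s \<le> t i"
  shows "s * norm (W c) \<le> norm (A (W c))"
proof -
  obtain e :: "'m \<Rightarrow> nat" where e: "bij_betw e UNIV {0..<CARD('m)}"
    using ex_bij_betw_finite_nat[OF finite_class.finite_UNIV] by blast
  have elt: "e j < CARD('m)" for j using e by (auto simp: bij_betw_def)
  have einj: "e i = e j \<longleftrightarrow> i = j" for i j using e by (auto simp: bij_betw_def inj_def)
  have "\<exists>c. v (e j) = W c" for j
  proof -
    obtain c where c: "B (A (v (e j))) = W c" using rng by blast
    have "t (e j) \<noteq> 0" using s elt[of j] by (metis less_le_not_le)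
    then have "complex_of_real (1 / (t (e j))\<^sup>2) *\<^sub>C B (A (v (e j))) = v (e j)"
      by (simp add: ev[OF elt] scaleC_scaleC scaleC_one)
    then have "W (complex_of_real (1 / (t (e j))\<^sup>2) *\<^sub>C c) = v (e j)"
      unfolding c clinear_scaleC[OF W] .
    then have "v (e j) = W (complex_of_real (1 / (t (e j))\<^sup>2) *\<^sub>C c)" by (rule sym)
    then show ?thesis by blast
  qed
  then obtain q where q: "\<And>j. v (e j) = W (q j)" by metis
  define X where "X = (\<chi> j. v (e j))"
  define Q where "Q = qmap (\<chi> j. q j)"
  have X: "orthonormal_columns X" by (simp add: orthonormal_columns_def X_def on[OF elt elt] einj)
  have WQ: "W (Q d) = qmap X d" for d
    by (simp add: Q_def qmap_def clinear_sum[OF W] clinear_scaleC[OF W] X_def q)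
  have "inj Q"
  proof -
    have "d = 0" if "Q d = 0" for d
      using WQ[of d] norm_qmap_orthonormal[OF X, of d] that by (simp add: clinear_zero[OF W])
    then show ?thesis using clinear_inj_iff[OF clinear_qmap] unfolding Q_def by blast
  qed
  then have "surj Q" unfolding Q_def by (rule clinear_inj_imp_surj[OF clinear_qmap])
  then obtain d where "c = Q d" by (rule surjE)
  then have Wc: "W c = qmap X d" by (simp add: WQ)
  define d' where "d' = (\<chi> j. complex_of_real ((t (e j))\<^sup>2) * d $ j)"
  have "B (A (qmap X d)) = qmap X d'"
    by (simp add: qmap_def d'_def clinear_sum[OF A] clinear_sum[OF B] clinear_scaleC[OF A]
        clinear_scaleC[OF B] X_def ev[OF elt] scaleC_scaleC mult.commute)
  then have "cinner (A (W c)) (A (W c)) = cinner d d'"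
    by (simp add: Wc adj cinner_cadjoint_qmap cadjoint_qmap_orthonormal[OF X])
  also have "\<dots> = complex_of_real (\<Sum>j\<in>UNIV. (t (e j))\<^sup>2 * (cmod (d $ j))\<^sup>2)"
  proof -
    have "cnj z * (complex_of_real r * z) = complex_of_real (r * (cmod z)\<^sup>2)" for r z
      using complex_norm_square[of z] by (simp add: mult_ac)
    then show ?thesis
      by (simp only: of_real_sum cinner_vec_def cinner_complex_def d'_def vec_lambda_beta)
  qed
  finally have "(norm (A (W c)))\<^sup>2 = (\<Sum>j\<in>UNIV. (t (e j))\<^sup>2 * (cmod (d $ j))\<^sup>2)"
    unfolding cinner_self of_real_eq_iff .
  also have "\<dots> \<ge> (\<Sum>j\<in>UNIV. s\<^sup>2 * (cmod (d $ j))\<^sup>2)"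
    using s elt by (intro sum_mono mult_right_mono power_mono) (auto simp: less_imp_le)
  also have "(\<Sum>j\<in>UNIV. s\<^sup>2 * (cmod (d $ j))\<^sup>2) = (s * norm (W c))\<^sup>2"
    by (simp add: Wc norm_qmap_orthonormal[OF X] norm_vec_def L2_set_def power_mult_distrib sum_nonneg
        flip: sum_distrib_left)
  finally show ?thesis by (rule power2_le_imp_le) simp
qed

text \<open>For an operator of rank \<open>m\<close> whose adjoint maps into the \<open>m\<close>-dimensional range of \<open>W\<close>, the
  \<open>m\<close>-th singular value is positive and bounds \<open>A\<close> from below on that range, which is the
  orthogonal complement of the kernel.\<close>

lemma singular_value_properties:
  fixes A :: "'h::complex_inner \<Rightarrow> 'k::complex_inner" and W :: "complex ^ 'm \<Rightarrow> 'h"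
  assumes A: "clinear A" and B: "clinear B" and adj: "\<And>x y. cinner (A x) y = cinner x (B y)"
    and W: "clinear W" "inj W" and AW: "inj (\<lambda>c. A (W c))" and rng: "\<And>y. B y \<in> range W"
  shows "0 < singular_value CARD('m) A"
    and "singular_value CARD('m) A * norm (W c) \<le> norm (A (W c))"
proof -
  define S where "S = {s. \<exists>v t. (\<forall>i<CARD('m). \<forall>j<CARD('m). cinner (v i) (v j) = (if i = j then 1 else 0)) \<and>
    (\<forall>i<CARD('m). B (A (v i)) = complex_of_real ((t i)\<^sup>2) *\<^sub>C v i) \<and>
    0 \<le> s \<and> (\<forall>i<CARD('m). s \<le> t i)}"
  have sv: "singular_value CARD('m) A = Sup S"
    unfolding singular_value_def cadjoint_eq[OF adj] S_def ..
  have lb: "s * norm (W c) \<le> norm (A (W c))" if "s \<in> S" for s c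
  proof (cases "s = 0")
    case False
    obtain v t where vt: "\<forall>i<CARD('m). \<forall>j<CARD('m). cinner (v i) (v j) = (if i = j then 1 else 0)"
      "\<forall>i<CARD('m). B (A (v i)) = complex_of_real ((t i)\<^sup>2) *\<^sub>C v i"
      "0 \<le> s" "\<forall>i<CARD('m). s \<le> t i"
      using \<open>s \<in> S\<close> unfolding S_def by blast
    show ?thesis
      by (rule eigenvalue_lower_bound[OF A B adj W(1) rng, of v t]) (use vt False in auto)
  qed simp
  obtain v t where vt: "\<forall>i<CARD('m). \<forall>j<CARD('m). cinner (v i) (v j) = (if i = j then 1 else 0)"
    "\<forall>i<CARD('m). B (A (v i)) = complex_of_real ((t i)\<^sup>2) *\<^sub>C v i" "\<forall>i<CARD('m). (0::real) < t i"
    using orthonormal_eigenvectors[OF A adj W AW rng order_refl] by blast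
  define s0 where "s0 = Min (t ` {..<CARD('m)})"
  have ne: "t ` {..<CARD('m)} \<noteq> {}" by (simp add: lessThan_empty_iff)
  have s0: "s0 > 0" unfolding s0_def using vt(3) ne by (subst Min_gr_iff) auto
  have "s0 \<in> S"
    using vt s0 unfolding S_def by (intro CollectI exI[of _ v] exI[of _ t]) (auto simp: s0_def)
  have bound: "s \<le> norm (A (W c)) / norm (W c)" if "s \<in> S" "W c \<noteq> 0" for s c
    using lb[OF that(1), of c] that(2) by (simp add: field_simps)
  have "axis undefined 1 \<noteq> (0 :: complex ^ 'm)" by (simp add: axis_eq_0_iff)
  then have "W (axis undefined 1) \<noteq> 0" using W clinear_inj_iff by blast
  then have "bdd_above S" using bound by (intro bdd_aboveI) blast
  then have "s0 \<le> Sup S" using \<open>s0 \<in> S\<close> by (intro cSup_upper)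
  then show "0 < singular_value CARD('m) A" using s0 sv by simp
  show "singular_value CARD('m) A * norm (W c) \<le> norm (A (W c))"
  proof (cases "W c = 0")
    case False
    have "Sup S \<le> norm (A (W c)) / norm (W c)"
      using \<open>s0 \<in> S\<close> bound False by (intro cSup_least) auto
    then show ?thesis using False by (simp add: sv field_simps)
  qed simp
qed

section \<open>Pseudospectra and the norm of the resolvent\<close>

lemma
  assumes "op_invertible D A"
  shows op_invertible_in_dom: "the_inv_into D A y \<in> D"
    and op_invertible_right: "A (the_inv_into D A y) = y"
    and op_invertible_left: "x \<in> D \<Longrightarrow> the_inv_into D A (A x) = x"
  using assms unfolding op_invertible_def bij_betw_def
  by (metis UNIV_I order_refl the_inv_into_into, metis UNIV_I f_the_inv_into_f, simp add: the_inv_into_f_f)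

text \<open>The Neumann series argument: with \<open>S = A\<^sup>-\<^sup>1\<close>, the substitution \<open>x = S u\<close> turns
  \<open>A x + E x = y\<close> into the fixed point equation \<open>u = y - E (S u)\<close> of a contraction.\<close>

lemma op_invertible_perturb:
  fixes A :: "'h::chilbert_space \<Rightarrow> 'h" and E :: "'h \<Rightarrow>\<^sub>L 'h"
  assumes D: "complex_vector.subspace D" and A: "linear_on_dom D A" and inv: "op_invertible D A"
    and q: "0 \<le> q" "q < 1" "\<And>u. norm (E (the_inv_into D A u)) \<le> q * norm u"
  shows "op_invertible D (\<lambda>x. A x + E x)"
proof -
  define S where "S = the_inv_into D A"
  define P where "P = (\<lambda>x. A x + E x)"
  have S: "bounded_linear S" using inv by (simp add: op_invertible_def S_def)
  interpret S: bounded_linear S by (rule S)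
  have SD: "S u \<in> D" and AS: "A (S u) = u" for u
    using op_invertible_in_dom[OF inv] op_invertible_right[OF inv] by (simp_all add: S_def)
  have SA: "x \<in> D \<Longrightarrow> S (A x) = x" for x
    using op_invertible_left[OF inv] by (simp add: S_def)
  have q3: "norm (E (S u)) \<le> q * norm u" for u using q(3) by (simp add: S_def)
  have low: "(1 - q) * norm u \<le> norm (u + E (S u))" for u
    using q3[of u] norm_triangle_ineq2[of u "- E (S u)"] by (simp add: algebra_simps)
  have ex: "\<exists>u. u + E (S u) = y" for y
  proof -
    have "\<exists>!u. y - E (S u) = u"
    proof (rule banach_fix_type[OF q(1,2)], intro allI)
      fix a b
      have "(y - E (S a)) - (y - E (S b)) = - E (S (a - b))"
        by (simp add: S.diff blinfun.diff_right)
      then show "dist (y - E (S a)) (y - E (S b)) \<le> q * dist a b"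
        using q3[of "a - b"] by (simp add: dist_norm)
    qed
    then obtain u where "y - E (S u) = u" by blast
    then have "u + E (S u) = y" by (simp add: algebra_simps)
    then show ?thesis ..
  qed
  have inj0: "u = v" if "u + E (S u) = v + E (S v)" for u v
  proof -
    have "(u - v) + E (S (u - v)) = 0"
      using that by (simp add: S.diff blinfun.diff_right algebra_simps)
    then have "(1 - q) * norm (u - v) \<le> 0" using low[of "u - v"] by simp
    then show ?thesis using q(2) by (simp add: mult_le_0_iff)
  qed
  define U where "U y = (SOME u. u + E (S u) = y)" for y
  have U: "U y + E (S (U y)) = y" for y
    unfolding U_def by (rule someI_ex[OF ex])
  have PS: "P (S u) = u + E (S u)" for u by (simp add: P_def AS)
  have inj: "inj_on P D"
  proof (rule inj_onI)
    fix x y assume "x \<in> D" "y \<in> D" "P x = P y"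
    then have "A x + E (S (A x)) = A y + E (S (A y))" by (simp add: SA P_def)
    then have "A x = A y" by (rule inj0)
    then have "S (A x) = S (A y)" by (rule arg_cong)
    then show "x = y" by (simp only: SA \<open>x \<in> D\<close> \<open>y \<in> D\<close>)
  qed
  moreover have "y \<in> P ` D" for y
    by (rule image_eqI[of _ _ "S (U y)"]) (simp_all only: PS U SD)
  then have "P ` D = UNIV" by blast
  ultimately have bij: "bij_betw P D UNIV" by (simp add: bij_betw_def)
  have inv_eq: "the_inv_into D P y = S (U y)" for y
    by (rule the_inv_into_f_eq[OF inj]) (simp_all add: PS U SD)
  have Uadd: "U (x + y) = U x + U y" for x y
  proof (rule inj0)
    have "U x + U y + E (S (U x + U y)) = (U x + E (S (U x))) + (U y + E (S (U y)))"
      by (simp add: S.add blinfun.add_right algebra_simps)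
    then show "U (x + y) + E (S (U (x + y))) = U x + U y + E (S (U x + U y))"
      by (simp add: U)
  qed
  have Uscale: "U (r *\<^sub>R x) = r *\<^sub>R U x" for r x
  proof (rule inj0)
    have "r *\<^sub>R U x + E (S (r *\<^sub>R U x)) = r *\<^sub>R (U x + E (S (U x)))"
      by (simp add: S.scaleR blinfun.scaleR_right algebra_simps)
    then show "U (r *\<^sub>R x) + E (S (U (r *\<^sub>R x))) = r *\<^sub>R U x + E (S (r *\<^sub>R U x))"
      by (simp add: U)
  qed
  have "bounded_linear U"
  proof (rule bounded_linear_intro[OF Uadd Uscale])
    fix x
    show "norm (U x) \<le> norm x * (1 / (1 - q))"
      using low[of "U x"] q(2) by (simp add: U field_simps)
  qed
  from bounded_linear_compose[OF S this] have "bounded_linear (the_inv_into D P)"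
    by (simp add: inv_eq[abs_def])
  with bij show ?thesis unfolding op_invertible_def P_def by blast
qed

lemma pseudospectrum_resolvent_bound:
  assumes nep: "nonlinear_eigenproblem \<Omega> D T" and z: "z \<in> nep_pseudospectrum \<Omega> D T \<epsilon>"
    and inv: "op_invertible D (T z)"
    and K: "\<And>h. norm (the_inv_into D (T z) h) \<le> K * norm h" "0 < K" "K * \<epsilon> \<le> 1"
  shows False
proof -
  obtain E :: "complex \<Rightarrow> 'a \<Rightarrow>\<^sub>L 'a" where bdd: "bdd_above ((\<lambda>z. norm (E z)) ` \<Omega>)"
    and sup: "(SUP z\<in>\<Omega>. norm (E z)) < \<epsilon>"
    and sp: "z \<in> nep_spectrum \<Omega> D (\<lambda>z x. T z x + E z x)"
    using z unfolding nep_pseudospectrum_def by blast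
  have zO: "z \<in> \<Omega>" and ninv: "\<not> op_invertible D (\<lambda>x. T z x + E z x)"
    using sp by (simp_all add: nep_spectrum_def)
  have "norm (E z) < \<epsilon>" using cSUP_upper[OF zO bdd] sup by linarith
  then have "norm (E z) * K < 1" using K(2,3) by (metis mult.commute mult_strict_left_mono order_less_le_trans)
  moreover have "norm (E z (the_inv_into D (T z) u)) \<le> norm (E z) * K * norm u" for u
    using norm_blinfun[of "E z" "the_inv_into D (T z) u"] mult_left_mono[OF K(1)[of u], of "norm (E z)"]
    by (simp add: mult.assoc)
  ultimately have "op_invertible D (\<lambda>x. T z x + E z x)"
    using nep zO K(2) unfolding nonlinear_eigenproblem_def
    by (intro op_invertible_perturb[OF _ _ inv, of "norm (E z) * K"]) auto
  with ninv show False ..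
qed

text \<open>A vector \<open>h\<close> that the resolvent stretches to \<open>x\<close> yields a constant rank one perturbation
  \<open>E y = - (cinner x y / norm x\<^sup>2) h\<close> of norm \<open>norm h / norm x\<close> with \<open>(T z + E) x = 0\<close>.\<close>

lemma large_resolvent_in_pseudospectrum:
  assumes nep: "nonlinear_eigenproblem \<Omega> D T" and z: "z \<in> \<Omega>" and inv: "op_invertible D (T z)"
    and h: "norm h < \<epsilon> * norm (the_inv_into D (T z) h)"
  shows "z \<in> nep_pseudospectrum \<Omega> D T \<epsilon>"
proof -
  define x where "x = the_inv_into D (T z) h"
  have xD: "x \<in> D" and Tx: "T z x = h"
    using op_invertible_in_dom[OF inv] op_invertible_right[OF inv] by (simp_all add: x_def)
  have x0: "x \<noteq> 0" using h by (auto simp flip: x_def)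
  define a where "a = - complex_of_real (1 / (norm x)\<^sup>2)"
  have ca: "cmod a = 1 / (norm x)\<^sup>2" by (simp add: a_def norm_divide norm_power)
  define f where "f = (\<lambda>y. (a * cinner x y) *\<^sub>C h)"
  have cf: "clinear f"
    by (rule clinearI)
      (simp_all add: f_def cinner_add_right cinner_scaleC_right scaleC_add_left scaleC_scaleC algebra_simps)
  have fle: "norm (f y) \<le> norm y * (norm h / norm x)" for y
  proof -
    have "norm (f y) = 1 / (norm x)\<^sup>2 * cmod (cinner x y) * norm h"
      by (simp add: f_def norm_scaleC norm_mult ca)
    also have "\<dots> \<le> 1 / (norm x)\<^sup>2 * (norm x * norm y) * norm h"
      by (intro mult_right_mono mult_left_mono cinner_cauchy_schwarz) simp_all
    finally show ?thesis using x0 by (simp add: field_simps power2_eq_square)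
  qed
  have bf: "bounded_linear f"
    by (rule bounded_linear_intro[OF _ _ fle])
      (simp_all add: clinear_add[OF cf] clinear_scaleC[OF cf] scaleR_scaleC)
  define E where "E = Blinfun f"
  have Ef: "blinfun_apply E = f" unfolding E_def by (rule bounded_linear_Blinfun_apply[OF bf])
  have "norm E \<le> norm h / norm x"
    using fle by (intro norm_blinfun_bound) (simp_all add: Ef mult.commute)
  also have "\<dots> < \<epsilon>" using h x0 by (simp add: field_simps flip: x_def)
  finally have nE: "norm E < \<epsilon>" .
  have T0: "T z 0 = 0" and D0: "0 \<in> D"
  proof -
    have "complex_vector.subspace D" "linear_on_dom D (T z)"
      using nep z by (simp_all add: nonlinear_eigenproblem_def)
    then show "0 \<in> D" using complex_vector.subspace_0 by blast
    with \<open>linear_on_dom D (T z)\<close> have "T z (0 *\<^sub>C 0) = 0 *\<^sub>C T z 0" unfolding linear_on_dom_def by blast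
    then show "T z 0 = 0" by simp
  qed
  have "T z x + E x = T z 0 + E 0"
    using x0 by (simp add: Ef f_def Tx T0 cinner_self a_def cinner_zero_right scaleC_one)
  then have "\<not> inj_on (\<lambda>x. T z x + E x) D" using xD D0 x0 unfolding inj_on_def by blast
  then have "z \<in> nep_spectrum \<Omega> D (\<lambda>z x. T z x + E x)"
    using z by (simp add: nep_spectrum_def op_invertible_def bij_betw_def)
  moreover have "cholomorphic_on (\<lambda>z. E) \<Omega>"
    unfolding cholomorphic_on_def has_cderiv_def by (intro ballI exI[of _ 0]) simp
  moreover have "\<Omega> \<noteq> {}" using z by blast
  ultimately show ?thesis
    unfolding nep_pseudospectrum_def using nE cf
    by (intro UN_I[of "\<lambda>z. E"]) (simp_all add: Ef image_constant_conv)
qed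

lemma spectrum_subset_pseudospectrum:
  assumes "0 < \<epsilon>" shows "nep_spectrum \<Omega> D T \<subseteq> nep_pseudospectrum \<Omega> D T \<epsilon>"
proof
  fix z assume z: "z \<in> nep_spectrum \<Omega> D T"
  then have "\<Omega> \<noteq> {}" by (auto simp: nep_spectrum_def)
  moreover have "cholomorphic_on (\<lambda>z. 0 :: 'a \<Rightarrow>\<^sub>L 'a) \<Omega>"
    unfolding cholomorphic_on_def has_cderiv_def by (intro ballI exI[of _ 0]) simp
  moreover have "clinear (\<lambda>x :: 'a. 0 :: 'a)" by (rule clinearI) simp_all
  ultimately show "z \<in> nep_pseudospectrum \<Omega> D T \<epsilon>"
    unfolding nep_pseudospectrum_def using z assms
    by (intro UN_I[of "\<lambda>z. 0"]) (simp_all add: zero_blinfun.rep_eq image_constant_conv)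
qed

section \<open>Stieltjes integrals along rectifiable curves\<close>

lemma uniform_tagged_division:
  assumes "n > 0"
  defines "p \<equiv> (\<lambda>i. (real i / real n, {real i / real n .. real (Suc i) / real n})) ` {..<n}"
  shows "p tagged_division_of {0..1}"
proof -
  have union: "(\<Union>i<n. {real i / real n .. real (Suc i) / real n}) = {0..1}"
  proof (intro equalityI subsetI)
    fix x :: real assume "x \<in> {0..1}"
    then have x: "0 \<le> x" "x \<le> 1" by auto
    show "x \<in> (\<Union>i<n. {real i / real n .. real (Suc i) / real n})"
    proof (cases "x = 1")
      case True
      have "x \<in> {real (n - 1) / real n .. real (Suc (n - 1)) / real n}"
        using True assms(1) by (simp add: of_nat_diff field_simps)
      then show ?thesis using assms(1) by (intro UN_I[of "n - 1"]) auto
    next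
      case False
      define i where "i = nat \<lfloor>x * real n\<rfloor>"
      have i: "real i \<le> x * real n" "x * real n < real i + 1"
        using x by (simp_all add: i_def)
      moreover have "x * real n < real n" using False x assms(1) by simp
      ultimately have "i < n" by linarith
      then show ?thesis using i assms(1) by (intro UN_I[of i]) (auto simp: field_simps)
    qed
  next
    fix x :: real assume "x \<in> (\<Union>i<n. {real i / real n .. real (Suc i) / real n})"
    then obtain i where i: "i < n" "real i / real n \<le> x" "x \<le> real (Suc i) / real n" by auto
    have "0 \<le> real i / real n" "real (Suc i) / real n \<le> 1" using i(1) by simp_all
    with i(2,3) show "x \<in> {0..1}" unfolding atLeastAtMost_iff by linarith
  qed
  have dis: "{real i / real n <..< real (Suc i) / real n} \<inter> {real j / real n <..< real (Suc j) / real n} = {}"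
    if "i \<noteq> j" for i j
  proof -
    have "real (Suc i) / real n \<le> real j / real n \<or> real (Suc j) / real n \<le> real i / real n"
      using that assms(1) by (simp add: divide_le_cancel) linarith
    then show ?thesis by auto
  qed
  show ?thesis
    unfolding tagged_division_of_def tagged_partial_division_of_def
  proof (intro conjI allI impI)
    fix x1 k1 x2 k2
    assume *: "(x1, k1) \<in> p \<and> (x2, k2) \<in> p \<and> (x1, k1) \<noteq> (x2, k2)"
    from * obtain i where i: "(x1, k1) = (real i / real n, {real i / real n .. real (Suc i) / real n})"
      unfolding p_def by (elim conjE imageE)
    from * obtain j where j: "(x2, k2) = (real j / real n, {real j / real n .. real (Suc j) / real n})"
      unfolding p_def by (elim conjE imageE)
    have "i \<noteq> j" using * i j by metis
    moreover have "k1 = {real i / real n .. real (Suc i) / real n}"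
      "k2 = {real j / real n .. real (Suc j) / real n}" using i j by simp_all
    ultimately show "interior k1 \<inter> interior k2 = {}"
      using dis[OF \<open>i \<noteq> j\<close>] by (simp only: interior_atLeastAtMost_real)
  next
    fix x k assume xk: "(x, k) \<in> p"
    then show "x \<in> k" by (auto simp: p_def divide_right_mono)
    show "k \<subseteq> {0..1}" using xk union unfolding p_def by blast
    show "\<exists>a b. k = cbox a b" using xk unfolding p_def cbox_interval by blast
  next
    show "finite p" by (simp add: p_def)
    have "\<Union> {k. \<exists>x. (x, k) \<in> p} = (\<Union>i<n. {real i / real n .. real (Suc i) / real n})"
      by (auto simp: p_def)
    with union show "\<Union> {k. \<exists>x. (x, k) \<in> p} = {0..1}" by simp
  qed
qed

text \<open>On a mesh so fine that every piece of the curve stays in a ball inside \<open>S\<close>, each piece can be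
  deformed linearly into its chord.\<close>

lemma inscribed_polygon:
  fixes \<gamma> :: "real \<Rightarrow> complex"
  assumes \<gamma>: "path \<gamma>" "path_image \<gamma> \<subseteq> S" and n: "n > 0"
    and mesh: "\<And>s t. s \<in> {0..1} \<Longrightarrow> t \<in> {0..1} \<Longrightarrow> \<bar>s - t\<bar> \<le> 1 / real n \<Longrightarrow> dist (\<gamma> s) (\<gamma> t) < e"
    and ball: "\<And>x. x \<in> path_image \<gamma> \<Longrightarrow> ball x e \<subseteq> S"
    and k: "k \<le> n"
  shows "\<exists>q. valid_path q \<and> homotopic_paths S (subpath 0 (real k / real n) \<gamma>) q \<and>
    (\<forall>g. continuous_on S g \<longrightarrow>
      (g has_contour_integral
        (\<Sum>i<k. contour_integral (linepath (\<gamma> (real i / real n)) (\<gamma> (real (Suc i) / real n))) g)) q)"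
  using k
proof (induction k)
  case 0
  have "homotopic_paths S (subpath 0 0 \<gamma>) (linepath (\<gamma> 0) (\<gamma> 0))"
  proof -
    have "\<gamma> 0 \<in> S" using \<gamma>(2) by (auto simp: path_image_def)
    then show ?thesis by (simp add: subpath_refl linepath_refl[abs_def] homotopic_paths_refl path_image_def path_const image_subset_iff)
  qed
  then have "homotopic_paths S (subpath 0 (real 0 / real n) \<gamma>) (linepath (\<gamma> 0) (\<gamma> 0))" by simp
  moreover have "(g has_contour_integral
      (\<Sum>i<0. contour_integral (linepath (\<gamma> (real i / real n)) (\<gamma> (real (Suc i) / real n))) g))
      (linepath (\<gamma> 0) (\<gamma> 0))" for g
    by (simp only: lessThan_0 sum.empty has_contour_integral_trivial)
  ultimately show ?case using valid_path_linepath by blast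
next
  case (Suc k)
  define u where "u = real k / real n"
  define v where "v = real (Suc k) / real n"
  have uv: "0 \<le> u" "u \<le> v" "v - u = 1 / real n"
    using n by (simp_all add: u_def v_def divide_right_mono add_divide_distrib)
  have "v \<le> 1" using Suc.prems n unfolding v_def by (subst divide_le_eq_1_pos) auto
  note uv = uv this
  have "k \<le> n" using Suc.prems by simp
  from Suc.IH[OF this] obtain q where q: "valid_path q" "homotopic_paths S (subpath 0 u \<gamma>) q"
    and qint: "\<And>g. continuous_on S g \<Longrightarrow> (g has_contour_integral
        (\<Sum>i<k. contour_integral (linepath (\<gamma> (real i / real n)) (\<gamma> (real (Suc i) / real n))) g)) q"
    unfolding u_def by blast
  have im: "\<gamma> u \<in> path_image \<gamma>" using uv by (auto simp: path_image_def)
  have near: "\<gamma> t \<in> ball (\<gamma> u) e" if "u \<le> t" "t \<le> v" for t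
    using mesh[of u t] that uv by simp
  have seg: "closed_segment (\<gamma> u) (\<gamma> v) \<subseteq> ball (\<gamma> u) e"
    using near[of u] near[of v] uv by (intro closed_segment_subset convex_ball) simp_all
  have qfin: "pathfinish q = \<gamma> u"
    using homotopic_paths_imp_pathfinish[OF q(2)] by simp
  have piece: "homotopic_paths S (subpath u v \<gamma>) (linepath (\<gamma> u) (\<gamma> v))"
  proof (rule homotopic_paths_linear)
    show "path (subpath u v \<gamma>)" using \<gamma>(1) uv by (simp add: path_subpath)
    fix t :: real assume t: "t \<in> {0..1}"
    have "subpath u v \<gamma> t \<in> ball (\<gamma> u) e"
    proof -
      have "0 \<le> (v - u) * t" "(v - u) * t \<le> (v - u) * 1"
        using t uv(1,2) mult_left_mono[of t 1 "v - u"] by auto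
      then show ?thesis unfolding subpath_def by (intro near) auto
    qed
    moreover have "linepath (\<gamma> u) (\<gamma> v) t \<in> ball (\<gamma> u) e"
      using seg t by (metis imageI path_image_def path_image_linepath subsetD)
    ultimately show "closed_segment (subpath u v \<gamma> t) (linepath (\<gamma> u) (\<gamma> v) t) \<subseteq> S"
      using ball[OF im] by (meson closed_segment_subset convex_ball order_trans)
  qed simp_all
  have "homotopic_paths S (subpath 0 v \<gamma>) (subpath 0 u \<gamma> +++ subpath u v \<gamma>)"
    using \<gamma> uv by (intro homotopic_paths_sym[OF homotopic_join_subpaths]) auto
  also have "homotopic_paths S \<dots> (q +++ linepath (\<gamma> u) (\<gamma> v))"
    by (rule homotopic_paths_join[OF q(2) piece]) simp
  finally have hom: "homotopic_paths S (subpath 0 v \<gamma>) (q +++ linepath (\<gamma> u) (\<gamma> v))" .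
  have "(g has_contour_integral
      (\<Sum>i<Suc k. contour_integral (linepath (\<gamma> (real i / real n)) (\<gamma> (real (Suc i) / real n))) g))
      (q +++ linepath (\<gamma> u) (\<gamma> v))" if g: "continuous_on S g" for g
  proof -
    have "continuous_on (closed_segment (\<gamma> u) (\<gamma> v)) g"
      using g continuous_on_subset seg ball[OF im] by blast
    then have "(g has_contour_integral contour_integral (linepath (\<gamma> u) (\<gamma> v)) g) (linepath (\<gamma> u) (\<gamma> v))"
      by (intro has_contour_integral_integral contour_integrable_continuous_linepath)
    from has_contour_integral_join[OF qint[OF g] this q(1) valid_path_linepath]
    show ?thesis by (simp add: u_def v_def)
  qed
  moreover have "valid_path (q +++ linepath (\<gamma> u) (\<gamma> v))"
    using q(1) qfin by (simp add: valid_path_join)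
  ultimately show ?case using hom unfolding v_def by blast
qed

lemma has_curve_integralE:
  assumes "has_curve_integral f I \<gamma>" "\<epsilon> > 0"
  obtains \<delta> where "\<delta> > 0"
    "\<And>p. p tagged_division_of {0..1} \<Longrightarrow> \<forall>(t, K)\<in>p. Sup K - Inf K < \<delta> \<Longrightarrow>
      norm ((\<Sum>(t, K)\<in>p. (\<gamma> (Sup K) - \<gamma> (Inf K)) *\<^sub>C f (\<gamma> t)) - I) < \<epsilon>"
proof -
  from assms(1)[unfolded has_curve_integral_def, rule_format, OF assms(2)]
  show ?thesis using that by (elim exE conjE) presburger
qed

text \<open>Bridge from Stieltjes integrals along a rectifiable curve, which need not be piecewise
  differentiable, to contour integrals along inscribed polygons: on a fine mesh \<open>g\<close> is almost
  constant along each chord, so that Stieltjes sum and polygon integral differ by at most the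
  oscillation of \<open>g\<close> times the length of the curve.\<close>

lemma curve_integral_eq_contour_integral:
  assumes \<gamma>: "path \<gamma>" "rectifiable \<gamma>" and S: "open S" "path_image \<gamma> \<subseteq> S"
    and g: "continuous_on S g" and I: "has_curve_integral g I \<gamma>"
    and c: "\<And>q. valid_path q \<Longrightarrow> homotopic_paths S \<gamma> q \<Longrightarrow> (g has_contour_integral c) q"
  shows "I = c"
proof (rule ccontr)
  assume "I \<noteq> c"
  define \<epsilon> where "\<epsilon> = dist I c / 2"
  have \<epsilon>: "\<epsilon> > 0" using \<open>I \<noteq> c\<close> by (simp add: \<epsilon>_def)
  obtain L where L: "\<And>p. p division_of {0..1} \<Longrightarrow> (\<Sum>K\<in>p. cmod (\<gamma> (Sup K) - \<gamma> (Inf K))) \<le> L"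
    using \<gamma>(2) unfolding rectifiable_def bdd_above_def by auto
  have "{{0..1::real}} division_of {0..1}" using division_of_self[of "0::real" 1] by simp
  from L[OF this] have L0: "0 \<le> L" by (simp add: order_trans[OF norm_ge_zero])
  define \<eta> where "\<eta> = \<epsilon> / (L + 1)"
  have \<eta>: "\<eta> > 0" "\<eta> * L < \<epsilon>" using \<epsilon> L0 by (simp_all add: \<eta>_def field_simps)
  obtain e where e: "e > 0" "(\<Union>x\<in>path_image \<gamma>. cball x e) \<subseteq> S"
    using compact_subset_open_imp_cball_epsilon_subset[OF compact_path_image[OF \<gamma>(1)] S] by blast
  \<comment> \<open>A compact neighbourhood of the curve that contains the chords and makes \<open>g\<close> uniformly
    continuous.\<close>
  define N where "N = {x + y |x y. x \<in> path_image \<gamma> \<and> y \<in> cball 0 e}"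
  have "compact N" unfolding N_def by (intro compact_sums compact_path_image \<gamma> compact_cball)
  have inN: "y \<in> N" if "x \<in> path_image \<gamma>" "dist x y \<le> e" for x y
    unfolding N_def using that by (intro CollectI exI[of _ x] exI[of _ "y - x"]) (simp add: dist_norm norm_minus_commute)
  have "N \<subseteq> S"
  proof
    fix z assume "z \<in> N"
    then obtain x y where "x \<in> path_image \<gamma>" "y \<in> cball 0 e" "z = x + y" by (auto simp: N_def)
    then have "z \<in> (\<Union>x\<in>path_image \<gamma>. cball x e)" by (intro UN_I[of x]) (auto simp: dist_norm)
    with e(2) show "z \<in> S" by blast
  qed
  then have "uniformly_continuous_on N g"
    using \<open>compact N\<close> continuous_on_subset[OF g] compact_uniformly_continuous by blast
  then obtain d where d: "d > 0" "\<And>x y. x \<in> N \<Longrightarrow> y \<in> N \<Longrightarrow> dist y x < d \<Longrightarrow> dist (g y) (g x) < \<eta>"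
    unfolding uniformly_continuous_on_def using \<eta>(1) by metis
  have "uniformly_continuous_on {0..1} \<gamma>"
    using \<gamma>(1) by (simp add: path_def compact_uniformly_continuous)
  moreover have "min e d > 0" using d e by simp
  ultimately obtain r where r: "r > 0" "\<And>s t. s \<in> {0..1} \<Longrightarrow> t \<in> {0..1} \<Longrightarrow> dist t s < r \<Longrightarrow> dist (\<gamma> t) (\<gamma> s) < min e d"
    unfolding uniformly_continuous_on_def by metis
  obtain \<delta> where \<delta>: "\<delta> > 0" "\<And>p. p tagged_division_of {0..1} \<Longrightarrow> \<forall>(t, K)\<in>p. Sup K - Inf K < \<delta> \<Longrightarrow>
      norm ((\<Sum>(t, K)\<in>p. (\<gamma> (Sup K) - \<gamma> (Inf K)) *\<^sub>C g (\<gamma> t)) - I) < \<epsilon>"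
    using has_curve_integralE[OF I \<epsilon>] by blast
  obtain n :: nat where n: "n > 0" "1 / real n < min r \<delta>"
    using real_arch_inverse[of "min r \<delta>"] r \<delta> by (auto simp: inverse_eq_divide)
  define K where "K i = {real i / real n .. real (Suc i) / real n}" for i
  define a where "a i = \<gamma> (real i / real n)" for i
  have ordK: "real i / real n \<le> real (Suc i) / real n" for i by (simp add: divide_right_mono)
  have supK: "Sup (K i) = real (Suc i) / real n" "Inf (K i) = real i / real n" for i
    unfolding K_def by (rule cSup_atLeastAtMost[OF ordK], rule cInf_atLeastAtMost[OF ordK])
  define p where "p = (\<lambda>i. (real i / real n, K i)) ` {..<n}"
  have p: "p tagged_division_of {0..1}"
    unfolding p_def K_def by (rule uniform_tagged_division[OF n(1)])
  have inj: "inj_on (\<lambda>i. (real i / real n, K i)) A" "inj_on K A" for A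
  proof -
    show "inj_on K A" 
    proof (rule inj_onI)
      fix i j assume "K i = K j"
      then have "Inf (K i) = Inf (K j)" by simp
      then show "i = j" using n(1) by (simp add: supK)
    qed
    then show "inj_on (\<lambda>i. (real i / real n, K i)) A" by (auto simp: inj_on_def)
  qed
  have "norm ((\<Sum>(t, K)\<in>p. (\<gamma> (Sup K) - \<gamma> (Inf K)) *\<^sub>C g (\<gamma> t)) - I) < \<epsilon>"
  proof (rule \<delta>(2)[OF p])
    show "\<forall>(t, K)\<in>p. Sup K - Inf K < \<delta>"
      using n by (auto simp: p_def supK add_divide_distrib)
  qed
  then have 1: "cmod ((\<Sum>i<n. (a (Suc i) - a i) * g (a i)) - I) < \<epsilon>"
    unfolding p_def sum.reindex[OF inj(1)] by (simp add: supK a_def scaleC_complex_def)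
  have "(\<Sum>K\<in>K ` {..<n}. cmod (\<gamma> (Sup K) - \<gamma> (Inf K))) \<le> L"
  proof (rule L)
    have "snd ` p = K ` {..<n}" by (simp add: p_def image_image)
    then show "K ` {..<n} division_of {0..1}" using division_of_tagged_division[OF p] by simp
  qed
  then have 2: "(\<Sum>i<n. cmod (a (Suc i) - a i)) \<le> L"
    unfolding sum.reindex[OF inj(2)] by (simp add: supK a_def)
  have mesh: "dist (\<gamma> s) (\<gamma> t) < min e d" if "s \<in> {0..1}" "t \<in> {0..1}" "\<bar>s - t\<bar> \<le> 1 / real n" for s t
    using r(2)[OF that(2,1)] that(3) n(2) by (simp add: dist_real_def)
  have cball: "ball x (min e d) \<subseteq> S" if "x \<in> path_image \<gamma>" for x using e that by fastforce
  obtain q where q: "valid_path q" "homotopic_paths S (subpath 0 (real n / real n) \<gamma>) q"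
    "(g has_contour_integral (\<Sum>i<n. contour_integral (linepath (a i) (a (Suc i))) g)) q"
    using inscribed_polygon[OF \<gamma>(1) S(2) n(1) mesh cball order_refl] g unfolding a_def by blast
  have "homotopic_paths S \<gamma> q" using q(2) n(1) by simp
  from c[OF q(1) this] q(3) have ceq: "c = (\<Sum>i<n. contour_integral (linepath (a i) (a (Suc i))) g)"
    by (rule has_contour_integral_unique)
  have "cmod (contour_integral (linepath (a i) (a (Suc i))) g - (a (Suc i) - a i) * g (a i))
      \<le> \<eta> * cmod (a (Suc i) - a i)" if i: "i < n" for i
  proof -
    have unit: "real i / real n \<in> {0..1}" "real (Suc i) / real n \<in> {0..1}" using i by auto
    have ai: "a i \<in> path_image \<gamma>" using unit by (auto simp: a_def path_image_def)
    have "dist (\<gamma> (real i / real n)) (\<gamma> (real (Suc i) / real n)) < min e d"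
      by (rule mesh[OF unit]) (simp add: add_divide_distrib)
    then have dst: "dist (a i) (a (Suc i)) < min e d" by (simp add: a_def)
    have "closed_segment (a i) (a (Suc i)) \<subseteq> ball (a i) (min e d)"
      using dst e d by (intro closed_segment_subset) auto
    then have segN: "x \<in> N" "dist x (a i) < d" if "x \<in> closed_segment (a i) (a (Suc i))" for x
      using that inN[OF ai, of x] by (auto simp: dist_commute)
    have "continuous_on (closed_segment (a i) (a (Suc i))) g"
      by (rule continuous_on_subset[OF g]) (use segN(1) \<open>N \<subseteq> S\<close> in blast)
    then have "(g has_contour_integral contour_integral (linepath (a i) (a (Suc i))) g) (linepath (a i) (a (Suc i)))"
      by (intro has_contour_integral_integral contour_integrable_continuous_linepath)
    from has_contour_integral_diff[OF this has_contour_integral_const_linepath[of "g (a i)"]]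
    show ?thesis
    proof (subst mult.commute[of _ "g (a i)"], rule has_contour_integral_bound_linepath)
      fix x assume "x \<in> closed_segment (a i) (a (Suc i))"
      then show "cmod (g x - g (a i)) \<le> \<eta>"
        using d(2)[of "a i" x] segN inN[OF ai, of "a i"] e(1) by (simp add: dist_norm less_imp_le)
    qed (use \<eta> in simp)
  qed
  then have "cmod (c - (\<Sum>i<n. (a (Suc i) - a i) * g (a i))) \<le> (\<Sum>i<n. \<eta> * cmod (a (Suc i) - a i))"
    unfolding ceq sum_subtractf[symmetric] by (intro sum_norm_le) auto
  also have "\<dots> \<le> \<eta> * L" using 2 \<eta>(1) by (simp flip: sum_distrib_left)
  also have "\<dots> < \<epsilon>" by (rule \<eta>)
  finally have "dist I c < \<epsilon> + \<epsilon>"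
    using 1 by (metis dist_commute dist_norm dist_triangle_less_add)
  then show False by (simp add: \<epsilon>_def)
qed

text \<open>Vector-valued integrals are evaluated by testing against all vectors \<open>w\<close>.\<close>

lemma has_curve_integral_cinner:
  assumes "has_curve_integral f I \<gamma>"
    and eq: "\<And>z. z \<in> path_image \<gamma> \<Longrightarrow> cinner w (f z) = g z"
  shows "has_curve_integral g (cinner w I) \<gamma>"
  unfolding has_curve_integral_def
proof (intro allI impI)
  fix \<epsilon> :: real assume \<epsilon>: "\<epsilon> > 0"
  define \<eta> where "\<eta> = \<epsilon> / (norm w + 1)"
  have w1: "norm w + 1 > 0" using norm_ge_zero[of w] by linarith
  then have \<eta>: "\<eta> > 0" "norm w * \<eta> < \<epsilon>" using \<epsilon> by (simp_all add: \<eta>_def field_simps)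
  obtain \<delta> where \<delta>: "\<delta> > 0" "\<And>p. p tagged_division_of {0..1} \<Longrightarrow> \<forall>(t, K)\<in>p. Sup K - Inf K < \<delta> \<Longrightarrow>
      norm ((\<Sum>(t, K)\<in>p. (\<gamma> (Sup K) - \<gamma> (Inf K)) *\<^sub>C f (\<gamma> t)) - I) < \<eta>"
    using has_curve_integralE[OF assms(1) \<eta>(1)] by blast
  have "norm ((\<Sum>(t, K)\<in>p. (\<gamma> (Sup K) - \<gamma> (Inf K)) *\<^sub>C g (\<gamma> t)) - cinner w I) < \<epsilon>"
    if p: "p tagged_division_of {0..1}" "\<forall>(t, K)\<in>p. Sup K - Inf K < \<delta>" for p
  proof -
    have "t \<in> {0..1}" if "(t, K) \<in> p" for t K
      using tagged_division_ofD(2,3)[OF p(1) that] by blast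
    then have "(\<Sum>(t, K)\<in>p. (\<gamma> (Sup K) - \<gamma> (Inf K)) *\<^sub>C g (\<gamma> t))
        = (\<Sum>(t, K)\<in>p. cinner w ((\<gamma> (Sup K) - \<gamma> (Inf K)) *\<^sub>C f (\<gamma> t)))"
      by (intro sum.cong) (auto simp: cinner_scaleC_right scaleC_complex_def eq path_image_def)
    also have "\<dots> = cinner w (\<Sum>(t, K)\<in>p. (\<gamma> (Sup K) - \<gamma> (Inf K)) *\<^sub>C f (\<gamma> t))"
      by (simp add: cinner_sum_right case_prod_unfold)
    finally have "norm ((\<Sum>(t, K)\<in>p. (\<gamma> (Sup K) - \<gamma> (Inf K)) *\<^sub>C g (\<gamma> t)) - cinner w I)
        = cmod (cinner w ((\<Sum>(t, K)\<in>p. (\<gamma> (Sup K) - \<gamma> (Inf K)) *\<^sub>C f (\<gamma> t)) - I))"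
      by (simp add: cinner_diff_right)
    also have "\<dots> \<le> norm w * norm ((\<Sum>(t, K)\<in>p. (\<gamma> (Sup K) - \<gamma> (Inf K)) *\<^sub>C f (\<gamma> t)) - I)"
      by (rule cinner_cauchy_schwarz)
    also have "\<dots> \<le> norm w * \<eta>" using \<delta>(2)[OF p] by (intro mult_left_mono) auto
    also have "\<dots> < \<epsilon>" by (rule \<eta>)
    finally show ?thesis .
  qed
  with \<delta>(1) show "\<exists>\<delta>>0. \<forall>p. p tagged_division_of {0..1} \<and> (\<forall>(t, K)\<in>p. Sup K - Inf K < \<delta>) \<longrightarrow>
      norm ((\<Sum>(t, K)\<in>p. (\<gamma> (Sup K) - \<gamma> (Inf K)) *\<^sub>C g (\<gamma> t)) - cinner w I) < \<epsilon>"
    by blast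
qed

section \<open>Contour moments of the resolvent of a Jordan matrix\<close>

lemma clinear_matrix_vector: "clinear ((*v) (A :: complex ^ 'n ^ 'm))"
proof (rule clinearI)
  show "A *v (x + y) = A *v x + A *v y" for x y by (rule matrix_vector_right_distrib)
  show "A *v (c *\<^sub>C x) = c *\<^sub>C (A *v x)" for c x
    by (simp add: matrix_vector_mult_def vec_eq_iff scaleC_vec_def scaleC_complex_def
        sum_distrib_left mult.left_commute)
qed

lemma shifted_matrix_vector: "(mat z - J) *v x = z *\<^sub>C x - J *v x"
proof -
  have "mat z *v x = z *\<^sub>C x"
    by (simp add: matrix_vector_mult_def mat_def vec_eq_iff scaleC_vec_def scaleC_complex_def
        if_distrib[of "\<lambda>a. a * _"] cong: if_cong)
  then show ?thesis by (simp add: matrix_vector_mult_diff_rdistrib)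
qed

lemma jordan_blocks_cover:
  assumes "jordan_blocks bs J"
  obtains l ks a where "(l, ks) \<in> set bs" "a < length ks" "i = ks ! a"
proof -
  have "i \<in> set (concat (map snd bs))" using assms by (simp add: jordan_blocks_def)
  then obtain b where "b \<in> set bs" "i \<in> set (snd b)" by auto
  then show ?thesis using that[of "fst b" "snd b"] by (auto simp: in_set_conv_nth)
qed

lemma jordan_blocks_row:
  assumes J: "jordan_blocks bs J" and b: "(l, ks) \<in> set bs" and a: "a < length ks"
  shows "(J *v x) $ (ks ! a) = l * x $ (ks ! a) + (if Suc a < length ks then x $ (ks ! Suc a) else 0)"
proof -
  have row: "J $ (ks ! a) $ j = (if j = ks ! a then l else if Suc a < length ks \<and> j = ks ! Suc a then 1 else 0)" for j
    using J b a unfolding jordan_blocks_def by fastforce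
  have "distinct ks"
    using J b unfolding jordan_blocks_def by (auto simp: distinct_concat_iff)
  then have ne: "Suc a < length ks \<Longrightarrow> ks ! Suc a \<noteq> ks ! a"
    by (simp add: nth_eq_iff_index_eq)
  have "(J *v x) $ (ks ! a) = (\<Sum>j\<in>UNIV. (if j = ks ! a then l * x $ j else 0) +
      (if j = ks ! Suc a then if Suc a < length ks then x $ j else 0 else 0))"
    unfolding matrix_vector_mult_def vec_lambda_beta row using ne by (intro sum.cong) auto
  also have "\<dots> = l * x $ (ks ! a) + (if Suc a < length ks then x $ (ks ! Suc a) else 0)"
    by (simp add: sum.distrib)
  finally show ?thesis .
qed

text \<open>Induction from the last row of a block upwards: a row of \<open>z I - J\<close> couples an entry only with
  the next one.\<close>

lemma jordan_block_induct:
  assumes "a < length ks"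
    and "\<And>a. a < length ks \<Longrightarrow> (Suc a < length ks \<Longrightarrow> P (Suc a)) \<Longrightarrow> P a"
  shows "P a"
  using assms(1) by (induction rule: strict_inc_induct) (use assms(2) in auto)

text \<open>At an eigenvalue the last row of a block of \<open>z I - J\<close> vanishes; elsewhere back substitution
  through each block shows that the kernel is trivial.\<close>

lemma jordan_singular_iff:
  assumes J: "jordan_blocks bs J"
  shows "inj ((*v) (mat z - J)) \<longleftrightarrow> z \<notin> fst ` set bs"
proof
  assume "inj ((*v) (mat z - J))"
  then have surj: "surj ((*v) (mat z - J))"
    by (rule clinear_inj_imp_surj[OF clinear_matrix_vector])
  show "z \<notin> fst ` set bs"
  proof
    assume "z \<in> fst ` set bs"
    then obtain ks where b: "(z, ks) \<in> set bs" by auto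
    have "ks \<noteq> []" using J b unfolding jordan_blocks_def by fastforce
    define a where "a = length ks - 1"
    have a: "a < length ks" "\<not> Suc a < length ks" using \<open>ks \<noteq> []\<close> by (auto simp: a_def)
    obtain x where x: "axis (ks ! a) 1 = (mat z - J) *v x" using surj by (rule surjE)
    have "axis (ks ! a) 1 $ (ks ! a) = (0 :: complex)"
      unfolding x shifted_matrix_vector
      using jordan_blocks_row[OF J b a(1), of x] a(2) by (simp add: scaleC_vec_def scaleC_complex_def)
    then show False by simp
  qed
next
  assume z: "z \<notin> fst ` set bs"
  have "x = 0" if "(mat z - J) *v x = 0" for x
  proof -
    have "x $ i = 0" for i
    proof -
      obtain l ks a where b: "(l, ks) \<in> set bs" "a < length ks" "i = ks ! a"
        using jordan_blocks_cover[OF J] .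
      have "z \<noteq> l" using b z by force
      have "x $ (ks ! a) = 0" using b(2)
      proof (rule jordan_block_induct)
        fix a assume a: "a < length ks" and IH: "Suc a < length ks \<Longrightarrow> x $ (ks ! Suc a) = 0"
        have "((mat z - J) *v x) $ (ks ! a) = 0" by (simp add: that)
        then have "(z - l) * x $ (ks ! a) = 0"
          using IH unfolding shifted_matrix_vector
          by (simp add: jordan_blocks_row[OF J b(1) a] scaleC_vec_def scaleC_complex_def algebra_simps split: if_splits)
        then show "x $ (ks ! a) = 0" using \<open>z \<noteq> l\<close> by simp
      qed
      with b show ?thesis by simp
    qed
    then show ?thesis by (simp add: vec_eq_iff)
  qed
  then show "inj ((*v) (mat z - J))" using clinear_inj_iff[OF clinear_matrix_vector] by blast
qed

lemma jordan_resolvent: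
  assumes J: "jordan_blocks bs J" and z: "z \<notin> fst ` set bs"
  shows "(mat z - J) *v (matrix_inv (mat z - J) *v w) = w"
    and "matrix_inv (mat z - J) *v ((mat z - J) *v w) = w"
proof -
  have "invertible (mat z - J)"
    unfolding invertible_left_inverse matrix_left_invertible_injective
    using jordan_singular_iff[OF J] z by blast
  then have "(mat z - J) ** matrix_inv (mat z - J) = mat 1 \<and> matrix_inv (mat z - J) ** (mat z - J) = mat 1"
    unfolding invertible_def matrix_inv_def by (rule someI_ex)
  then show "(mat z - J) *v (matrix_inv (mat z - J) *v w) = w"
    "matrix_inv (mat z - J) *v ((mat z - J) *v w) = w"
    by (simp_all only: matrix_vector_mul_assoc matrix_vector_mul_lid)
qed

text \<open>Back substitution for \<open>(z I - J) y = w\<close>.\<close>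

lemma jordan_resolvent_row:
  assumes J: "jordan_blocks bs J" and b: "(l, ks) \<in> set bs" "a < length ks"
    and z: "z \<notin> fst ` set bs"
  shows "(matrix_inv (mat z - J) *v w) $ (ks ! a) =
    (w $ (ks ! a) + (if Suc a < length ks then (matrix_inv (mat z - J) *v w) $ (ks ! Suc a) else 0)) / (z - l)"
proof -
  define y where "y = matrix_inv (mat z - J) *v w"
  have "z \<noteq> l" using b z by force
  have "w $ (ks ! a) = ((mat z - J) *v y) $ (ks ! a)"
    by (simp only: y_def jordan_resolvent(1)[OF J z])
  also have "\<dots> = z * y $ (ks ! a) - (l * y $ (ks ! a) + (if Suc a < length ks then y $ (ks ! Suc a) else 0))"
    unfolding shifted_matrix_vector
    by (simp add: jordan_blocks_row[OF J b] scaleC_vec_def scaleC_complex_def)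
  finally show ?thesis using \<open>z \<noteq> l\<close> unfolding y_def[symmetric] by (simp add: field_simps)
qed

lemma jordan_resolvent_holomorphic:
  assumes J: "jordan_blocks bs J"
  shows "(\<lambda>z. (matrix_inv (mat z - J) *v w) $ i) holomorphic_on - fst ` set bs"
proof -
  obtain l ks a where b: "(l, ks) \<in> set bs" "a < length ks" "i = ks ! a"
    using jordan_blocks_cover[OF J] .
  have "(\<lambda>z. (matrix_inv (mat z - J) *v w) $ (ks ! a)) holomorphic_on - fst ` set bs" using b(2)
  proof (rule jordan_block_induct)
    fix a assume a: "a < length ks"
      and IH: "Suc a < length ks \<Longrightarrow> (\<lambda>z. (matrix_inv (mat z - J) *v w) $ (ks ! Suc a)) holomorphic_on - fst ` set bs"
    have "(\<lambda>z. (w $ (ks ! a) + (if Suc a < length ks then (matrix_inv (mat z - J) *v w) $ (ks ! Suc a) else 0)) / (z - l))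
        holomorphic_on - fst ` set bs"
      using IH b(1) by (cases "Suc a < length ks") (force intro!: holomorphic_intros)+
    then show "(\<lambda>z. (matrix_inv (mat z - J) *v w) $ (ks ! a)) holomorphic_on - fst ` set bs"
      by (rule holomorphic_transform) (use jordan_resolvent_row[OF J b(1) a] in simp)
  qed
  with b show ?thesis by simp
qed

lemma contour_integral_inverse_power:
  assumes q: "valid_path q" "pathfinish q = pathstart q" "l \<notin> path_image q" "winding_number q l = 1"
  shows "((\<lambda>z. 1 / (z - l) ^ Suc m) has_contour_integral (if m = 0 then 2 * of_real pi * \<i> else 0)) q"
proof (cases m)
  case 0
  then show ?thesis using has_contour_integral_winding_number[OF q(1,3)] q(4) by simp
next
  case (Suc k)
  have "((\<lambda>z. (- 1 / of_nat m) * inverse (z - l) ^ m) has_field_derivative 1 / (z - l) ^ Suc m)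
      (at z within - {l})" if "z \<in> - {l}" for z
  proof -
    have "((\<lambda>z. inverse (z - l)) has_field_derivative - (inverse (z - l) * 1 * inverse (z - l)))
        (at z within - {l})"
      using that by (intro DERIV_inverse') (auto intro!: derivative_eq_intros)
    from DERIV_cmult[OF DERIV_power[OF this, of m], of "- 1 / of_nat m"]
    have "((\<lambda>z. (- 1 / of_nat m) * inverse (z - l) ^ m) has_field_derivative
        (- 1 / of_nat m) * (of_nat m * (- (inverse (z - l) * 1 * inverse (z - l)) * inverse (z - l) ^ (m - Suc 0))))
        (at z within - {l})" .
    moreover have "(- 1 / of_nat m) * (of_nat m * x) = - x" for x :: complex
    proof -
      have "of_nat m \<noteq> (0 :: complex)" unfolding of_nat_eq_0_iff using Suc by simp
      then show ?thesis by simp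
    qed
    moreover have "inverse (z - l) * inverse (z - l) * inverse (z - l) ^ (m - Suc 0) = 1 / (z - l) ^ Suc m"
      by (simp add: Suc divide_inverse power_inverse mult_ac)
    ultimately show ?thesis by simp
  qed
  from Cauchy_theorem_primitive[OF this q(1) _ q(2)] q(3) show ?thesis by (simp add: Suc)
qed

text \<open>Every step of the back substitution divides by \<open>z - l\<close>, so the residue of an entry at \<open>l\<close> comes
  from the inhomogeneity \<open>w\<close> alone. To let the induction run, the entry is divided by a further
  power \<open>(z - l) ^ m\<close>, and the integral vanishes as soon as \<open>m > 0\<close>.\<close>

lemma jordan_resolvent_integral:
  assumes J: "jordan_blocks bs J"
    and q: "valid_path q" "pathfinish q = pathstart q"
    and l: "\<And>l. l \<in> fst ` set bs \<Longrightarrow> l \<notin> path_image q \<and> winding_number q l = 1"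
  shows "((\<lambda>z. (matrix_inv (mat z - J) *v w) $ i) has_contour_integral 2 * of_real pi * \<i> * w $ i) q"
proof -
  obtain l ks a where b: "(l, ks) \<in> set bs" "a < length ks" "i = ks ! a"
    using jordan_blocks_cover[OF J] .
  have lq: "l \<notin> path_image q" "winding_number q l = 1" using l[of l] b(1) by force+
  have "\<forall>m. ((\<lambda>z. (matrix_inv (mat z - J) *v w) $ (ks ! a) / (z - l) ^ m)
      has_contour_integral (if m = 0 then 2 * of_real pi * \<i> * w $ (ks ! a) else 0)) q" using b(2)
  proof (rule jordan_block_induct, intro allI)
    fix a m assume a: "a < length ks"
      and IH: "Suc a < length ks \<Longrightarrow> \<forall>m. ((\<lambda>z. (matrix_inv (mat z - J) *v w) $ (ks ! Suc a) / (z - l) ^ m)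
        has_contour_integral (if m = 0 then 2 * of_real pi * \<i> * w $ (ks ! Suc a) else 0)) q"
    have rest: "((\<lambda>z. (if Suc a < length ks then (matrix_inv (mat z - J) *v w) $ (ks ! Suc a) else 0) / (z - l) ^ Suc m)
        has_contour_integral 0) q"
    proof (cases "Suc a < length ks")
      case True
      then show ?thesis using IH[OF True, rule_format, of "Suc m"] by simp
    qed (simp add: has_contour_integral_0)
    have eq: "w $ (ks ! a) * (if m = 0 then 2 * of_real pi * \<i> else 0) + 0 =
        (if m = 0 then 2 * of_real pi * \<i> * w $ (ks ! a) else 0)" by simp
    from has_contour_integral_add[OF
        has_contour_integral_lmul[OF contour_integral_inverse_power[OF q lq], of "w $ (ks ! a)" m] rest]
    have "((\<lambda>z. w $ (ks ! a) * (1 / (z - l) ^ Suc m) +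
        (if Suc a < length ks then (matrix_inv (mat z - J) *v w) $ (ks ! Suc a) else 0) / (z - l) ^ Suc m)
        has_contour_integral (if m = 0 then 2 * of_real pi * \<i> * w $ (ks ! a) else 0)) q"
      unfolding eq .
    then show "((\<lambda>z. (matrix_inv (mat z - J) *v w) $ (ks ! a) / (z - l) ^ m)
        has_contour_integral (if m = 0 then 2 * of_real pi * \<i> * w $ (ks ! a) else 0)) q"
    proof (rule has_contour_integral_eq)
      fix z assume "z \<in> path_image q"
      then have "z \<notin> fst ` set bs" using l by blast
      from jordan_resolvent_row[OF J b(1) a this, of w]
      show "w $ (ks ! a) * (1 / (z - l) ^ Suc m) +
        (if Suc a < length ks then (matrix_inv (mat z - J) *v w) $ (ks ! Suc a) else 0) / (z - l) ^ Suc m =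
        (matrix_inv (mat z - J) *v w) $ (ks ! a) / (z - l) ^ m"
        by (simp add: add_divide_distrib)
    qed
  qed
  from this[rule_format, of 0] b(3) show ?thesis by simp
qed

section \<open>Moments of the Keldysh expansion\<close>

lemma cholomorphic_on_continuous:
  assumes "cholomorphic_on f S" shows "continuous_on S f"
proof -
  have "isCont f z" if "z \<in> S" for z
    using assms that has_derivative_continuous unfolding cholomorphic_on_def has_cderiv_def by blast
  then show ?thesis by (rule continuous_at_imp_continuous_on[OF ballI])
qed

lemma cholomorphic_on_matrix_element:
  fixes R :: "complex \<Rightarrow> 'h \<Rightarrow>\<^sub>L 'h::complex_inner"
  assumes R: "cholomorphic_on R S"
  shows "(\<lambda>z. cinner u (R z v)) holomorphic_on S"
proof -
  define \<phi> where "\<phi> = (\<lambda>B :: 'h \<Rightarrow>\<^sub>L 'h. cinner u (B v))"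
  have "bounded_linear \<phi>"
  proof (rule bounded_linear_intro[where K = "norm u * norm v"])
    fix A B :: "'h \<Rightarrow>\<^sub>L 'h" and r :: real
    show "\<phi> (A + B) = \<phi> A + \<phi> B" by (simp add: \<phi>_def blinfun.add_left cinner_add_right)
    show "\<phi> (r *\<^sub>R A) = r *\<^sub>R \<phi> A"
      unfolding \<phi>_def blinfun.scaleR_left
      by (simp add: scaleR_scaleC cinner_scaleC_right scaleC_complex_def)
    have "norm (\<phi> A) \<le> norm u * norm (A v)" unfolding \<phi>_def by (rule cinner_cauchy_schwarz)
    also have "\<dots> \<le> norm u * (norm A * norm v)" by (intro mult_left_mono norm_blinfun) simp
    finally show "norm (\<phi> A) \<le> norm A * (norm u * norm v)" by (simp add: mult_ac)
  qed
  have "(\<lambda>z. \<phi> (R z)) field_differentiable at z within S" if "z \<in> S" for z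
  proof -
    obtain d where "(R has_derivative (\<lambda>h. h *\<^sub>C d)) (at z)"
      using R \<open>z \<in> S\<close> unfolding cholomorphic_on_def has_cderiv_def by blast
    from bounded_linear.has_derivative[OF \<open>bounded_linear \<phi>\<close> this]
    have "((\<lambda>z. \<phi> (R z)) has_derivative (\<lambda>h. h * \<phi> d)) (at z)"
      by (simp add: \<phi>_def scaleC_blinfun.rep_eq cinner_scaleC_right)
    then have "((\<lambda>z. \<phi> (R z)) has_field_derivative \<phi> d) (at z)"
      by (simp add: has_field_derivative_def mult.commute[of _ "\<phi> d"])
    then have "(\<lambda>z. \<phi> (R z)) field_differentiable at z"
      unfolding field_differentiable_def by (rule exI)
    then show ?thesis by (rule field_differentiable_at_within)
  qed
  then show ?thesis by (simp add: holomorphic_on_def \<phi>_def)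
qed

text \<open>The moments are \<open>V W\<^sup>* v\<close> and \<open>V J W\<^sup>* v\<close>. After testing against \<open>u\<close>, the integrand is continuous
  on the neighbourhood \<open>S\<close> of the curve, where the eigenvalues inside are removed, and the
  integral may be taken along closed paths \<open>q\<close> homotopic to the curve in \<open>S\<close>. These wind once
  around each eigenvalue and not at all around points outside \<open>N\<close>: the holomorphic remainder
  integrates to zero by Cauchy's theorem and the Jordan part has been computed before. For the first
  moment, \<open>z y = w + J y\<close> reduces \<open>z y\<close> to \<open>y\<close> and a constant.\<close>

lemma keldysh_moments:
  fixes V W :: "'h::chilbert_space ^ 'm" and J :: "complex ^ 'm ^ 'm"
  assumes adm: "admissible_contour \<Omega> D T \<gamma>" and kel: "keldysh_expansion \<Omega> D T \<gamma> V W J R"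
  shows keldysh_zeroth_moment: "has_curve_integral (\<lambda>z. the_inv_into D (T z) v) I \<gamma> \<Longrightarrow>
      I = (2 * of_real pi * \<i>) *\<^sub>C qmap V (cadjoint (qmap W) v)"
    and keldysh_first_moment: "has_curve_integral (\<lambda>z. z *\<^sub>C the_inv_into D (T z) v) I \<gamma> \<Longrightarrow>
      I = (2 * of_real pi * \<i>) *\<^sub>C qmap V (J *v cadjoint (qmap W) v)"
proof -
  define w where "w = cadjoint (qmap W) v"
  define y where "y z = matrix_inv (mat z - J) *v w" for z
  obtain bs where J: "jordan_blocks bs J"
    and eig: "fst ` set bs = nep_spectrum \<Omega> D T \<inter> curve_interior \<gamma>"
    using kel unfolding keldysh_expansion_def by blast
  obtain N where N: "open N" "closure (curve_interior \<gamma>) \<subseteq> N" "cholomorphic_on R N"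
    and exp: "\<And>z h. z \<in> N - nep_spectrum \<Omega> D T \<Longrightarrow> the_inv_into D (T z) h =
          qmap V (matrix_inv (mat z - J) *v cadjoint (qmap W) h) + blinfun_apply (R z) h"
    using kel unfolding keldysh_expansion_def by blast
  have simple: "simple_path \<gamma>" and loop: "pathfinish \<gamma> = pathstart \<gamma>" and rect: "rectifiable \<gamma>"
    and wn: "\<And>z. z \<in> curve_interior \<gamma> \<Longrightarrow> winding_number \<gamma> z = 1"
    and disj: "path_image \<gamma> \<inter> nep_spectrum \<Omega> D T = {}"
    using adm unfolding admissible_contour_def by blast+
  have path: "path \<gamma>" using simple by (rule simple_path_imp_path)
  have "frontier (curve_interior \<gamma>) = path_image \<gamma>"
    using Jordan_inside_outside[OF simple loop] by blast
  then have imN: "path_image \<gamma> \<subseteq> N" using N(2) by (auto simp: frontier_def)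
  define S where "S = N - fst ` set bs"
  have "open S" unfolding S_def using N(1) by (intro open_Diff finite_imp_closed) simp_all
  have imS: "path_image \<gamma> \<subseteq> S" using imN disj eig by (auto simp: S_def)
  have exp_im: "the_inv_into D (T z) v = qmap V (y z) + R z v" if "z \<in> path_image \<gamma>" for z
    using exp[of z v] that imN disj by (auto simp: y_def w_def)
  have yhol: "(\<lambda>z. y z $ i) holomorphic_on S" for i
    unfolding y_def by (rule holomorphic_on_subset[OF jordan_resolvent_holomorphic[OF J]]) (auto simp: S_def)
  have zy: "z * y z $ i = w $ i + (J *v y z) $ i" if "z \<in> S" for z i
  proof -
    have "w = (mat z - J) *v y z"
      unfolding y_def using that by (subst jordan_resolvent(1)[OF J]) (auto simp: S_def)
    then have "w = z *\<^sub>C y z - J *v y z" by (simp only: shifted_matrix_vector)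
    then show ?thesis by (simp add: scaleC_vec_def scaleC_complex_def)
  qed
  have q: "valid_path q" "pathfinish q = pathstart q" "path_image q \<subseteq> S"
      "((\<lambda>z. y z $ i) has_contour_integral 2 * of_real pi * \<i> * w $ i) q"
      "f holomorphic_on N \<Longrightarrow> (f has_contour_integral 0) q"
    if "valid_path q" "homotopic_paths S \<gamma> q" for q i f
  proof -
    show vq: "valid_path q" by (rule that(1))
    show lq: "pathfinish q = pathstart q"
      using homotopic_paths_imp_pathstart[OF that(2)] homotopic_paths_imp_pathfinish[OF that(2)] loop
      by simp
    show iq: "path_image q \<subseteq> S" using homotopic_paths_imp_subset[OF that(2)] by simp
    have wq: "winding_number q z = winding_number \<gamma> z" if "z \<notin> S" for z
    proof -
      have "S \<subseteq> - {z}" using that by blast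
      with \<open>homotopic_paths S \<gamma> q\<close> have "homotopic_paths (- {z}) \<gamma> q" by (rule homotopic_paths_subset)
      then show ?thesis by (rule winding_number_homotopic_paths[symmetric])
    qed
    show "((\<lambda>z. y z $ i) has_contour_integral 2 * of_real pi * \<i> * w $ i) q"
      unfolding y_def
    proof (rule jordan_resolvent_integral[OF J vq lq])
      fix l assume "l \<in> fst ` set bs"
      then have "l \<notin> S" "l \<in> curve_interior \<gamma>" using eig by (auto simp: S_def)
      then show "l \<notin> path_image q \<and> winding_number q l = 1" using iq wq wn by auto
    qed
    assume f: "f holomorphic_on N"
    show "(f has_contour_integral 0) q"
    proof (rule Cauchy_theorem_global[OF N(1) f vq lq])
      show "path_image q \<subseteq> N" using iq by (auto simp: S_def)
      fix z assume z: "z \<notin> N"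
      then have "z \<notin> curve_interior \<gamma>" "z \<notin> path_image \<gamma>" using N(2) imN closure_subset by blast+
      then have "z \<in> outside (path_image \<gamma>)" using inside_Un_outside[of "path_image \<gamma>"] by blast
      then have "winding_number \<gamma> z = 0" by (rule winding_number_zero_in_outside[OF path loop])
      then show "winding_number q z = 0" using wq[of z] z by (simp add: S_def)
    qed
  qed
  have Rhol: "(\<lambda>z. cinner u (R z v)) holomorphic_on N" for u
    by (rule cholomorphic_on_matrix_element[OF N(3)])
  have cq: "cinner u (qmap V x) = (\<Sum>i\<in>UNIV. cinner u (V $ i) * x $ i)" for u x
    by (simp add: qmap_def cinner_sum_right cinner_scaleC_right mult.commute)
  {
    assume int: "has_curve_integral (\<lambda>z. the_inv_into D (T z) v) I \<gamma>"
    show "I = (2 * of_real pi * \<i>) *\<^sub>C qmap V w"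
    proof (rule cinner_ext)
      fix u
      define g where "g z = (\<Sum>i\<in>UNIV. cinner u (V $ i) * y z $ i) + cinner u (R z v)" for z
      have "has_curve_integral g (cinner u I) \<gamma>"
        by (rule has_curve_integral_cinner[OF int]) (simp add: exp_im cinner_add_right cq g_def)
      moreover have "g holomorphic_on S"
        unfolding g_def
        by (intro holomorphic_intros yhol holomorphic_on_subset[OF Rhol]) (auto simp: S_def)
      moreover have "(g has_contour_integral (\<Sum>i\<in>UNIV. cinner u (V $ i) * (2 * of_real pi * \<i> * w $ i)) + 0) q"
        if "valid_path q" "homotopic_paths S \<gamma> q" for q
        unfolding g_def
        by (intro has_contour_integral_add has_contour_integral_sum has_contour_integral_lmul
            q(4)[OF that] q(5)[OF that Rhol]) simp
      ultimately have "cinner u I = (\<Sum>i\<in>UNIV. cinner u (V $ i) * (2 * of_real pi * \<i> * w $ i)) + 0"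
        by (intro curve_integral_eq_contour_integral[OF path rect \<open>open S\<close> imS] holomorphic_on_imp_continuous_on)
      then show "cinner u I = cinner u ((2 * of_real pi * \<i>) *\<^sub>C qmap V w)"
        by (simp add: cinner_scaleC_right cq sum_distrib_left mult_ac)
    qed
  }
  {
    assume int: "has_curve_integral (\<lambda>z. z *\<^sub>C the_inv_into D (T z) v) I \<gamma>"
    show "I = (2 * of_real pi * \<i>) *\<^sub>C qmap V (J *v w)"
    proof (rule cinner_ext)
      fix u
      define Jy where "Jy z i = (\<Sum>j\<in>UNIV. J $ i $ j * y z $ j)" for z i
      define g where "g z = (\<Sum>i\<in>UNIV. cinner u (V $ i) * (w $ i + Jy z i)) + z * cinner u (R z v)" for z
      have "has_curve_integral g (cinner u I) \<gamma>"
      proof (rule has_curve_integral_cinner[OF int])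
        fix z assume z: "z \<in> path_image \<gamma>"
        have "cinner u (z *\<^sub>C the_inv_into D (T z) v)
            = (\<Sum>i\<in>UNIV. cinner u (V $ i) * (z * y z $ i)) + z * cinner u (R z v)"
          by (simp add: exp_im[OF z] cinner_add_right cinner_scaleC_right cq algebra_simps sum_distrib_left)
        also have "\<dots> = g z"
          unfolding g_def Jy_def using zy[of z] imS z by (auto simp: matrix_vector_mult_def)
        finally show "cinner u (z *\<^sub>C the_inv_into D (T z) v) = g z" .
      qed
      moreover have "g holomorphic_on S"
        unfolding g_def Jy_def
        by (intro holomorphic_intros yhol holomorphic_on_subset[OF Rhol]) (auto simp: S_def)
      moreover have "(g has_contour_integral (\<Sum>i\<in>UNIV. cinner u (V $ i) *
          (0 + (\<Sum>j\<in>UNIV. J $ i $ j * (2 * of_real pi * \<i> * w $ j)))) + 0) q"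
        if hq: "valid_path q" "homotopic_paths S \<gamma> q" for q
      proof -
        have "((\<lambda>z. w $ i) has_contour_integral 0) q" for i by (rule q(5)[OF hq]) simp
        moreover have "((\<lambda>z. z * cinner u (R z v)) has_contour_integral 0) q"
          by (intro q(5)[OF hq] holomorphic_intros Rhol)
        ultimately show ?thesis
          unfolding g_def Jy_def
          by (intro has_contour_integral_add has_contour_integral_sum has_contour_integral_lmul
              q(4)[OF hq]) simp_all
      qed
      ultimately have "cinner u I = (\<Sum>i\<in>UNIV. cinner u (V $ i) *
          (0 + (\<Sum>j\<in>UNIV. J $ i $ j * (2 * of_real pi * \<i> * w $ j)))) + 0"
        by (intro curve_integral_eq_contour_integral[OF path rect \<open>open S\<close> imS] holomorphic_on_imp_continuous_on)
      then show "cinner u I = cinner u ((2 * of_real pi * \<i>) *\<^sub>C qmap V (J *v w))"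
        by (simp add: cinner_scaleC_right cq sum_distrib_left mult_ac matrix_vector_mult_def)
    qed
  }
qed

section \<open>Comparison of the two pseudospectra\<close>

lemma sigma_inf_le_norm:
  assumes A: "clinear A"
  shows "sigma_inf A * norm x \<le> norm (A x)"
proof (cases "x = 0")
  case False
  have "sigma_inf A \<le> norm (A (complex_of_real (1 / norm x) *\<^sub>C x))"
    unfolding sigma_inf_def using False
    by (intro cInf_lower bdd_belowI[of _ 0]) (auto simp: norm_scaleC norm_divide)
  also have "\<dots> = norm (A x) / norm x"
    by (simp add: clinear_scaleC[OF A] norm_scaleC norm_divide)
  finally show ?thesis using False by (simp add: field_simps)
qed simp

lemma sigma_inf_lessE:
  fixes A :: "complex ^ 'm \<Rightarrow> 'h::complex_inner"
  assumes "sigma_inf A < \<delta>"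
  obtains x where "norm x = 1" "norm (A x) < \<delta>"
proof -
  have "norm (axis undefined 1 :: complex ^ 'm) = 1" by simp
  then have "{norm (A x) |x. norm x = 1} \<noteq> {}" by blast
  from cInf_lessD[OF this assms[unfolded sigma_inf_def]] show ?thesis using that by blast
qed

text \<open>With \<open>x\<close> chosen such that \<open>B x = L\<^sup>-\<^sup>1 C h\<close>, one has \<open>V L\<^sup>-\<^sup>1 C h = V B x\<close> and \<open>V L B x = V C h\<close>, so
  that a lower bound of \<open>V L B\<close> controls \<open>x\<close> by \<open>h\<close>. In the application, \<open>V L B\<close> is \<open>- F z\<close>.\<close>

lemma factored_resolvent_upper_bound:
  assumes low: "\<And>x. \<delta> * norm x \<le> norm (V (L (B x)))" and \<delta>: "0 < \<delta>"
    and surj: "surj B" and L: "\<And>c. L (L' c) = c"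
    and a: "\<And>x. norm (V (B x)) \<le> a * norm x" "0 \<le> a" and b: "\<And>h. norm (V (C h)) \<le> b * norm h"
  shows "norm (V (L' (C h))) \<le> b * a / \<delta> * norm h"
proof -
  obtain x where x: "L' (C h) = B x" using surj by (rule surjE)
  have "\<delta> * norm x \<le> b * norm h"
    using low[of x] b[of h] L[of "C h"] by (simp add: x)
  then have "a * (\<delta> * norm x) \<le> a * (b * norm h)" using a(2) by (rule mult_left_mono)
  then have "a * norm x \<le> b * a / \<delta> * norm h" using \<delta> by (simp add: field_simps)
  with a(1)[of x] show ?thesis by (simp add: x)
qed

text \<open>Conversely, a vector \<open>x\<close> almost annihilated by \<open>V L B\<close> gives a vector \<open>h\<close> in the range of \<open>W\<close>
  with \<open>C h = L B x\<close>. It is small because \<open>V C\<close> is bounded below on that range, whereas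
  \<open>V L\<^sup>-\<^sup>1 C h = V B x\<close> is not small.\<close>

lemma factored_resolvent_lower_bound:
  assumes x: "norm (V (L (B x))) < \<delta>" and L: "\<And>c. L' (L c) = c"
    and surj: "surj (\<lambda>d. C (W d))"
    and s: "0 < s" "s \<le> norm (V (B x))" and t: "\<And>d. t * norm (W d) \<le> norm (V (C (W d)))"
  obtains h where "t * s * norm h < \<delta> * norm (V (L' (C h)))"
proof -
  obtain d where d: "C (W d) = L (B x)" using surjD[OF surj, of "L (B x)"] by auto
  have \<delta>: "0 < \<delta>" using x norm_ge_zero order_le_less_trans by blast
  have "s * (t * norm (W d)) < s * \<delta>"
    using t[of d] x s(1) by (intro mult_strict_left_mono) (auto simp: d)
  also have "\<dots> \<le> \<delta> * norm (V (L' (C (W d))))"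
    using s(2) \<delta> by (simp add: d L mult.commute)
  finally show ?thesis using that[of "W d"] by (simp add: mult_ac)
qed

theorem theorem3p1:
  fixes \<Omega> :: "complex set"
    and D :: "'h::chilbert_space set"
    and T :: "complex \<Rightarrow> 'h \<Rightarrow> 'h"
    and \<gamma> :: "real \<Rightarrow> complex"
    and V W :: "'h ^ 'm"
    and J :: "complex ^ 'm ^ 'm"
    and R :: "complex \<Rightarrow> 'h \<Rightarrow>\<^sub>L 'h"
    and p :: nat
    and \<V> A0 A1 :: "'h ^ 'n"
    and I0 I1 :: "'n \<Rightarrow> 'h"
    and U :: "'h ^ 'm"
    and \<Sigma>0 :: "complex ^ 'm ^ 'm"
    and V0 :: "(complex ^ 'n) ^ 'm"
    and F :: "complex \<Rightarrow> complex ^ 'm \<Rightarrow> 'h"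
    and M :: real
  assumes "nonlinear_eigenproblem \<Omega> D T"
    and "admissible_contour \<Omega> D T \<gamma>"
    and "keldysh_expansion \<Omega> D T \<gamma> V W J R"
    and "CARD('n) = CARD('m) + p"
    and "\<And>j. has_curve_integral (\<lambda>z. the_inv_into D (T z) (\<V> $ j)) (I0 j) \<gamma>"
    and "\<And>j. has_curve_integral (\<lambda>z. z *\<^sub>C the_inv_into D (T z) (\<V> $ j)) (I1 j) \<gamma>"
    and "\<And>j. A0 $ j = (1 / (2 * complex_of_real pi * \<i>)) *\<^sub>C I0 j"
    and "\<And>j. A1 $ j = (1 / (2 * complex_of_real pi * \<i>)) *\<^sub>C I1 j"
    and "rank_of (qmap A0) = CARD('m)"
    and "rank_of (qmap A1) = CARD('m)"
    and "economized_svd A0 U \<Sigma>0 V0"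
    and "rank_of (qmap V \<circ> cadjoint (qmap W) \<circ> qmap \<V> \<circ> qmap V0) = CARD('m)"
    and "\<And>z x. F z x = qmap A1 (qmap V0 x) - z *\<^sub>C qmap A0 (qmap V0 x)"
    and "M = (SUP z\<in>curve_interior \<gamma>. norm (R z))"
  shows "\<exists>\<delta>0>0. \<forall>\<delta>. 0 < \<delta> \<and> \<delta> < \<delta>0 \<longrightarrow>
    (let \<delta>1 = \<delta> / (onorm (qmap V \<circ> cadjoint (qmap W)) *
                      onorm (qmap V \<circ> cadjoint (qmap W) \<circ> qmap \<V>) + M * \<delta>);
         \<delta>2 = \<delta> / (singular_value CARD('m) (qmap V \<circ> cadjoint (qmap W)) *
                      singular_value CARD('m) (qmap V \<circ> cadjoint (qmap W) \<circ> qmap \<V>) - M * \<delta>)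
     in nep_pseudospectrum \<Omega> D T \<delta>1 \<inter> curve_interior \<gamma>
          \<subseteq> mat_pseudospectrum F \<delta> \<inter> curve_interior \<gamma> \<and>
        mat_pseudospectrum F \<delta> \<inter> curve_interior \<gamma>
          \<subseteq> nep_pseudospectrum \<Omega> D T \<delta>2 \<inter> curve_interior \<gamma>)"
proof -
  note nep = assms(1) and adm = assms(2) and kel = assms(3)
  define C where "C = cadjoint (qmap W)"
  define Q where "Q = qmap V \<circ> C"
  define P where "P = Q \<circ> qmap \<V>"
  define B where "B = (\<lambda>x. C (qmap \<V> (qmap V0 x)))"
  have lC: "clinear C" unfolding C_def by (rule clinear_cadjoint_qmap)
  have lB: "clinear B"
    unfolding B_def by (rule clinear_compose[OF lC clinear_compose[OF clinear_qmap clinear_qmap]])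
  have lQ: "clinear Q" using clinear_compose[OF clinear_qmap lC] by (simp add: Q_def comp_def)
  have lP: "clinear P" using clinear_compose[OF lQ clinear_qmap] by (simp add: P_def comp_def)

  have pi: "(1 / (2 * complex_of_real pi * \<i>)) *\<^sub>C (2 * of_real pi * \<i>) *\<^sub>C (x :: 'h) = x" for x
    by (simp add: scaleC_scaleC scaleC_one)
  have A0: "qmap A0 = P"
  proof
    fix x
    have "A0 $ j = Q (\<V> $ j)" for j
      unfolding assms(7) keldysh_zeroth_moment[OF adm kel assms(5)] pi by (simp add: Q_def C_def)
    then show "qmap A0 x = P x"
      by (simp add: P_def qmap_def[of A0] qmap_def[of \<V>] clinear_sum[OF lQ] clinear_scaleC[OF lQ])
  qed
  have A1: "qmap A1 x = qmap V (J *v C (qmap \<V> x))" for x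
  proof -
    have l: "clinear (\<lambda>v. qmap V (J *v C v))"
      by (rule clinear_compose[OF clinear_qmap clinear_compose[OF clinear_matrix_vector lC]])
    have "A1 $ j = qmap V (J *v C (\<V> $ j))" for j
      unfolding assms(8) keldysh_first_moment[OF adm kel assms(6)] pi by (simp add: C_def)
    then show ?thesis
      by (simp add: qmap_def[of A1] qmap_def[of \<V>] clinear_sum[OF l] clinear_scaleC[OF l])
  qed
  \<comment> \<open>The moments turn the matrix pencil into a product containing the shifted Jordan matrix.\<close>
  have F: "F z x = - qmap V ((mat z - J) *v B x)" for z x
    by (simp add: assms(13) A0 A1 P_def Q_def B_def shifted_matrix_vector clinear_diff[OF clinear_qmap]
        clinear_scaleC[OF clinear_qmap])
  have lF: "clinear (F z)" for z
    by (rule clinearI) (simp_all add: assms(13) clinear_add[OF clinear_qmap] clinear_scaleC[OF clinear_qmap]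
        scaleC_add_right complex_vector.scale_right_diff_distrib scaleC_scaleC mult.commute)

  have on: "orthonormal_columns V0" using assms(11) by (simp add: economized_svd_def)
  have "rank_of (\<lambda>x. qmap V (C (qmap \<V> x))) = CARD('m)"
    using assms(9) unfolding A0 by (simp add: P_def Q_def comp_def)
  from full_rank_factorization[OF clinear_qmap clinear_compose[OF lC clinear_qmap] this]
  have V_inj: "inj (qmap V)" and "surj (\<lambda>x. C (qmap \<V> x))" by auto
  then have C_surj: "surj C" by (auto simp: surj_def)
  have "rank_of (\<lambda>x. qmap V (B x)) = CARD('m)"
    using assms(12) by (simp add: B_def C_def comp_def)
  from full_rank_factorization[OF clinear_qmap lB this] have B_surj: "surj B" by simp
  then have B_inj: "inj B" by (rule clinear_surj_imp_inj[OF lB])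
  have W_inj: "inj (qmap W)"
  proof -
    have "c = 0" if "qmap W c = 0" for c
    proof -
      obtain h where "c = C h" using C_surj by (rule surjE)
      then have "cinner c c = cinner (qmap W c) h" by (simp add: C_def cinner_cadjoint_qmap)
      then show ?thesis by (simp add: that cinner_zero_left cinner_eq_zero_iff)
    qed
    then show ?thesis using clinear_inj_iff[OF clinear_qmap] by blast
  qed
  have lCW: "clinear (\<lambda>c. C (qmap W c))" by (rule clinear_compose[OF lC clinear_qmap])
  \<comment> \<open>The Gram matrix \<open>W\<^sup>* W\<close>.\<close>
  have CW_inj: "inj (\<lambda>c. C (qmap W c))"
  proof -
    have "c = 0" if "C (qmap W c) = 0" for c
    proof -
      have "cinner (qmap W c) (qmap W c) = cinner c (C (qmap W c))"
        by (simp add: C_def cinner_cadjoint_qmap)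
      then have "qmap W c = 0" by (simp add: that cinner_zero_right cinner_eq_zero_iff)
      then show ?thesis using W_inj clinear_inj_iff[OF clinear_qmap] by blast
    qed
    then show ?thesis using clinear_inj_iff[OF lCW] by blast
  qed
  then have CW_surj: "surj (\<lambda>c. C (qmap W c))" by (rule clinear_inj_imp_surj[OF lCW])

  define s where "s = singular_value CARD('m) P"
  define t where "t = singular_value CARD('m) Q"
  \<comment> \<open>The kernel of \<open>V W\<^sup>*\<close> is the orthogonal complement of the range of \<open>W\<close>.\<close>
  have t: "0 < t" "\<And>c. t * norm (qmap W c) \<le> norm (Q (qmap W c))"
  proof -
    define Q' where "Q' = (\<lambda>y. qmap W (cadjoint (qmap V) y))"
    have "clinear Q'" unfolding Q'_def by (rule clinear_compose[OF clinear_qmap clinear_cadjoint_qmap])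
    moreover have "cinner (Q x) y = cinner x (Q' y)" for x y
      by (simp add: Q_def Q'_def C_def cinner_cadjoint_qmap cinner_cadjoint_qmap')
    moreover have "inj (\<lambda>c. Q (qmap W c))"
      using inj_compose[OF V_inj CW_inj] by (simp add: Q_def comp_def)
    moreover have "Q' y \<in> range (qmap W)" for y by (simp add: Q'_def)
    ultimately show "0 < t" "\<And>c. t * norm (qmap W c) \<le> norm (Q (qmap W c))"
      unfolding t_def using singular_value_properties[OF lQ _ _ clinear_qmap W_inj] by blast+
  qed
  \<comment> \<open>The kernel of \<open>V W\<^sup>* \<V> = A\<^sub>0\<close> is the orthogonal complement of the range of \<open>V\<^sub>0\<close>.\<close>
  have s: "0 < s" "\<And>x. s * norm (qmap V0 x) \<le> norm (P (qmap V0 x))"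
  proof -
    obtain H where H: "clinear H"
        "\<And>x y. cinner (qmap A0 x) y = cinner x (qmap V0 (H (cadjoint (qmap U) y)))"
      using economized_svd_adjoint[OF assms(11)] by blast
    define P' where "P' = (\<lambda>y. qmap V0 (H (cadjoint (qmap U) y)))"
    have "clinear P'"
      unfolding P'_def by (rule clinear_compose[OF clinear_qmap clinear_compose[OF H(1) clinear_cadjoint_qmap]])
    moreover have "cinner (P x) y = cinner x (P' y)" for x y
      using H(2) by (simp add: A0 P'_def)
    moreover have "inj (\<lambda>c. P (qmap V0 c))"
      using inj_compose[OF V_inj B_inj] by (simp add: P_def Q_def B_def comp_def)
    moreover have "P' y \<in> range (qmap V0)" for y by (simp add: P'_def)
    moreover have "inj (qmap V0)"
      using norm_qmap_orthonormal[OF on] clinear_inj_iff[OF clinear_qmap, of V0] by (metis norm_eq_zero)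
    ultimately show "0 < s" "\<And>x. s * norm (qmap V0 x) \<le> norm (P (qmap V0 x))"
      unfolding s_def using singular_value_properties[OF lP _ _ clinear_qmap] by blast+
  qed
  have VB: "qmap V (B x) = P (qmap V0 x)" for x by (simp add: P_def Q_def B_def)

  have bQ: "bounded_linear Q"
    using bounded_linear_compose[OF bounded_linear_qmap bounded_linear_cadjoint_qmap]
    by (simp add: Q_def C_def comp_def)
  have bP: "bounded_linear P"
    using bounded_linear_compose[OF bQ bounded_linear_qmap] by (simp add: P_def comp_def)
  define a where "a = onorm P"
  define b where "b = onorm Q"
  have a: "norm (P x) \<le> a * norm x" and b: "norm (Q h) \<le> b * norm h" for x h
    using onorm[OF bP] onorm[OF bQ] by (simp_all add: a_def b_def)
  have "norm (axis undefined 1 :: complex ^ 'm) = 1" by simp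
  then obtain c :: "complex ^ 'm" where c: "norm c = 1" by blast
  have ab: "0 < a" "0 < b"
  proof -
    have "norm (qmap V0 c) = 1" by (simp add: norm_qmap_orthonormal[OF on] c)
    then show "0 < a" using s(1) s(2)[of c] a[of "qmap V0 c"] by simp
    have "c \<noteq> 0" using c by auto
    then have "norm (qmap W c) > 0" using W_inj clinear_inj_iff[OF clinear_qmap, of W] by auto
    moreover have "t * norm (qmap W c) \<le> b * norm (qmap W c)"
      using t(2)[of c] b[of "qmap W c"] by simp
    ultimately show "0 < b" using t(1) by (simp add: mult_le_cancel_right)
  qed

  obtain bs where J: "jordan_blocks bs J"
    and eig: "fst ` set bs = nep_spectrum \<Omega> D T \<inter> curve_interior \<gamma>"
    using kel unfolding keldysh_expansion_def by blast
  obtain N where N: "open N" "closure (curve_interior \<gamma>) \<subseteq> N" "cholomorphic_on R N"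
    and exp: "\<And>z h. z \<in> N - nep_spectrum \<Omega> D T \<Longrightarrow> the_inv_into D (T z) h =
          qmap V (matrix_inv (mat z - J) *v cadjoint (qmap W) h) + blinfun_apply (R z) h"
    using kel unfolding keldysh_expansion_def by blast
  have in\<Omega>: "curve_interior \<gamma> \<subseteq> \<Omega>" using adm by (simp add: admissible_contour_def)
  have inside: "curve_interior \<gamma> \<noteq> {}" "bounded (curve_interior \<gamma>)"
    using adm Jordan_inside_outside[of \<gamma>] by (auto simp: admissible_contour_def)
  have bdd: "bdd_above ((\<lambda>z. norm (R z)) ` curve_interior \<gamma>)"
  proof -
    have "continuous_on (closure (curve_interior \<gamma>)) (\<lambda>z. norm (R z))"
      using continuous_on_subset[OF cholomorphic_on_continuous[OF N(3)] N(2)] by (rule continuous_on_norm)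
    then have "compact ((\<lambda>z. norm (R z)) ` closure (curve_interior \<gamma>))"
      using inside(2) by (intro compact_continuous_image) (simp_all add: compact_closure)
    then have "bdd_above ((\<lambda>z. norm (R z)) ` closure (curve_interior \<gamma>))"
      by (intro bounded_imp_bdd_above compact_imp_bounded)
    then show ?thesis by (rule bdd_above_mono) (intro image_mono closure_subset)
  qed
  have RM: "norm (R z) \<le> M" if "z \<in> curve_interior \<gamma>" for z
    unfolding assms(14) by (rule cSUP_upper[OF that bdd])
  have M0: "0 \<le> M"
  proof -
    obtain z where "z \<in> curve_interior \<gamma>" using inside(1) by blast
    from RM[OF this] show ?thesis by (rule order_trans[OF norm_ge_zero])
  qed

  have resolvent: "op_invertible D (T z)"
      "the_inv_into D (T z) h = qmap V (matrix_inv (mat z - J) *v C h) + R z h"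
      "(mat z - J) *v (matrix_inv (mat z - J) *v x) = x"
      "matrix_inv (mat z - J) *v ((mat z - J) *v x) = x"
      "norm (R z h) \<le> M * norm h"
    if z: "z \<in> curve_interior \<gamma>" "z \<notin> nep_spectrum \<Omega> D T" for z h x
  proof -
    show "op_invertible D (T z)" using z in\<Omega> by (auto simp: nep_spectrum_def)
    have "z \<in> N" using z(1) N(2) closure_subset by blast
    then show "the_inv_into D (T z) h = qmap V (matrix_inv (mat z - J) *v C h) + R z h"
      using exp[of z h] z(2) by (simp add: C_def)
    have "z \<notin> fst ` set bs" using z eig by blast
    then show "(mat z - J) *v (matrix_inv (mat z - J) *v x) = x"
      "matrix_inv (mat z - J) *v ((mat z - J) *v x) = x"
      by (rule jordan_resolvent[OF J])+
    have "norm (R z h) \<le> norm (R z) * norm h" by (rule norm_blinfun)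
    also have "\<dots> \<le> M * norm h" by (intro mult_right_mono RM z) simp
    finally show "norm (R z h) \<le> M * norm h" .
  qed

  have upper: "z \<in> mat_pseudospectrum F \<delta>"
    if z: "z \<in> curve_interior \<gamma>" "z \<in> nep_pseudospectrum \<Omega> D T (\<delta> / (b * a + M * \<delta>))" and \<delta>: "0 < \<delta>" for z \<delta>
  proof (rule ccontr)
    assume "z \<notin> mat_pseudospectrum F \<delta>"
    then have sig: "\<delta> \<le> sigma_inf (F z)" by (simp add: mat_pseudospectrum_def)
    have low: "\<delta> * norm x \<le> norm (qmap V ((mat z - J) *v B x))" for x
      using sigma_inf_le_norm[OF lF, of z x] mult_right_mono[OF sig, of "norm x"] by (simp add: F)
    show False
    proof (cases "z \<in> nep_spectrum \<Omega> D T")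
      case True
      then have "\<not> inj ((*v) (mat z - J))" using z(1) eig jordan_singular_iff[OF J] by blast
      then obtain y where y: "y \<noteq> 0" "(mat z - J) *v y = 0"
        using clinear_inj_iff[OF clinear_matrix_vector] by blast
      obtain x where x: "y = B x" using B_surj by (rule surjE)
      have "x \<noteq> 0" using y(1) by (auto simp: x clinear_zero[OF lB])
      then show False
        using low[of x] y(2) \<delta> by (simp add: clinear_zero[OF clinear_qmap] mult_le_0_iff flip: x)
    next
      case False
      note res = resolvent[OF z(1) False]
      have "norm (the_inv_into D (T z) h) \<le> (b * a / \<delta> + M) * norm h" for h
      proof -
        have "norm (qmap V (matrix_inv (mat z - J) *v C h)) \<le> b * a / \<delta> * norm h"
        proof (rule factored_resolvent_upper_bound[where L = "(*v) (mat z - J)", OF low \<delta> B_surj res(3)])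
          show "norm (qmap V (B x)) \<le> a * norm x" for x
            using a[of "qmap V0 x"] by (simp add: VB norm_qmap_orthonormal[OF on])
          show "norm (qmap V (C h)) \<le> b * norm h" for h using b[of h] by (simp add: Q_def)
        qed (use ab in simp)
        then show ?thesis
          using res(5)[of h] unfolding res(2) by (intro norm_triangle_le) (simp add: distrib_right)
      qed
      moreover have "0 < b * a / \<delta> + M" using ab \<delta> M0 by (simp add: add_pos_nonneg)
      moreover have "(b * a / \<delta> + M) * (\<delta> / (b * a + M * \<delta>)) = 1"
      proof -
        have "b * a + M * \<delta> > 0" using ab \<delta> M0 by (simp add: add_pos_nonneg)
        moreover have "b * a / \<delta> + M = (b * a + M * \<delta>) / \<delta>" using \<delta> by (simp add: field_simps)
        ultimately show ?thesis using \<delta> by simp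
      qed
      ultimately show False
        using pseudospectrum_resolvent_bound[OF nep z(2) res(1)] by (metis order_refl)
    qed
  qed

  have lower: "z \<in> nep_pseudospectrum \<Omega> D T (\<delta> / (t * s - M * \<delta>))"
    if z: "z \<in> curve_interior \<gamma>" "z \<in> mat_pseudospectrum F \<delta>" and \<delta>: "0 < \<delta>" "M * \<delta> < t * s" for z \<delta>
  proof (cases "z \<in> nep_spectrum \<Omega> D T")
    case True
    have "0 < \<delta> / (t * s - M * \<delta>)" using \<delta> by simp
    from spectrum_subset_pseudospectrum[OF this] True show ?thesis by blast
  next
    case False
    note res = resolvent[OF z(1) False]
    obtain x where x: "norm x = 1" "norm (F z x) < \<delta>"
      using sigma_inf_lessE z(2) unfolding mat_pseudospectrum_def by blast
    have Fx: "norm (qmap V ((mat z - J) *v B x)) < \<delta>" using x(2) by (simp add: F)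
    have sx: "s \<le> norm (qmap V (B x))"
      using s(2)[of x] by (simp add: VB norm_qmap_orthonormal[OF on] x(1))
    have tQ: "t * norm (qmap W d) \<le> norm (qmap V (C (qmap W d)))" for d
      using t(2)[of d] by (simp add: Q_def)
    obtain h where h: "t * s * norm h < \<delta> * norm (qmap V (matrix_inv (mat z - J) *v C h))"
      using factored_resolvent_lower_bound[where V = "qmap V" and L = "(*v) (mat z - J)"
          and L' = "(*v) (matrix_inv (mat z - J))" and B = B and C = C and W = "qmap W", OF Fx res(4) CW_surj s(1) sx tQ] .
    have "qmap V (matrix_inv (mat z - J) *v C h) = the_inv_into D (T z) h - R z h"
      by (simp add: res(2))
    then have "norm (qmap V (matrix_inv (mat z - J) *v C h)) \<le> norm (the_inv_into D (T z) h) + M * norm h"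
      using norm_triangle_ineq4[of "the_inv_into D (T z) h" "R z h"] res(5)[of h] by simp
    then have "\<delta> * norm (qmap V (matrix_inv (mat z - J) *v C h))
        \<le> \<delta> * (norm (the_inv_into D (T z) h) + M * norm h)"
      using \<delta>(1) by (intro mult_left_mono) simp_all
    with h have "(t * s - M * \<delta>) * norm h < \<delta> * norm (the_inv_into D (T z) h)"
      by (simp add: algebra_simps)
    then have "norm h < \<delta> / (t * s - M * \<delta>) * norm (the_inv_into D (T z) h)"
      using \<delta>(2) by (simp add: field_simps)
    then show ?thesis
      using z(1) in\<Omega> by (intro large_resolvent_in_pseudospectrum[OF nep _ res(1)]) auto
  qed

  \<comment> \<open>The threshold keeps the denominator of \<open>\<delta>2\<close> positive; the summand 1 covers \<open>M = 0\<close>.\<close>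
  have "M * \<delta> < t * s" if "0 < \<delta>" "\<delta> < t * s / (M + 1)" for \<delta>
  proof -
    have "M * \<delta> \<le> (M + 1) * \<delta>" using that(1) by (simp add: algebra_simps)
    also have "\<dots> < t * s" using that(2) M0 by (simp add: field_simps)
    finally show ?thesis .
  qed
  moreover have "0 < t * s / (M + 1)" using s(1) t(1) M0 by simp
  ultimately show ?thesis
    using upper lower
    unfolding Let_def C_def[symmetric] Q_def[symmetric] P_def[symmetric] a_def[symmetric]
      b_def[symmetric] s_def[symmetric] t_def[symmetric]
    by (intro exI[of _ "t * s / (M + 1)"]) blast
qed

end
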